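(* Let $\mathbb{F}_q$ be a finite field with $q=p^k$ elements ($p$ prime, $k\ge 1$) and $q\equiv 1\pmod 3$. For $z\in\mathbb{F}_q$ and $n\ge 1$ let $A_n(z)$ denote the number of $(x_1,\dots,x_n)\in\mathbb{F}_q^n$ with $x_1^3+x_2^3+\cdots+x_n^3=z$. Let $z\in\mathbb{F}_q^{\ast}$. Then, as formal power series in $x$, $$\sum_{n=1}^{\infty}A_n(z)x^n=\frac{x}{1-qx}+\frac{2x+(c-2)x^2-cx^3}{1-3qx^2-qcx^3}$$ if $z$ is cubic, and $$\sum_{n=1}^{\infty}A_n(z)x^n=\frac{x}{1-qx}-\frac{x+\frac{1}{2}(4+c-9d)x^2+cx^3}{1-3qx^2-qcx^3}$$ if $z$ is non-cubic, where $c,d$ are the integers uniquely determined by $$4q=c^2+27d^2,\quad c\equiv 1\pmod 3,\quad (c,p)=1 \text{ if } p\equiv 1\pmod 3,\quad 9d\equiv c\left(2z^{\frac{q-1}{3}}+1\right)\pmod p,$$ where in the last congruence $z^{(q-1)/3}\in\mathbb{F}_q$ is a cube root of unity lying in the prime field $\mathbb{F}_p$, identified with an integer residue mod $p$.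
   Context: An element $z\in\mathbb{F}_q^{\ast}$ is called cubic if $z=y^3$ for some $y\in\mathbb{F}_q^{\ast}$, and non-cubic otherwise.
   Formalization: For cubic z the congruence on 9d is dropped (no c,d satisfy it when p≡1 mod 3, e.g. q=7, z=1) and only c is claimed unique; the congruence is read as an equality in F_q, since for p≡2 mod 3 and z non-cubic z^((q-1)/3) is not in F_p. *)

theory Defs
  imports
    "HOL-Library.Cardinality"
    "HOL-Number_Theory.Number_Theory"
    "HOL-Computational_Algebra.Computational_Algebra"
begin

definition cubic :: "'a::field \<Rightarrow> bool" where
  "cubic z \<longleftrightarrow> (\<exists>y. y \<noteq> 0 \<and> z = y ^ 3)"

text \<open>The elements of \<open>F\<^sub>q\<^sup>n\<close> are the lists of length \<open>n\<close> over the field type.\<close>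

definition num_sol :: "nat \<Rightarrow> 'a::{field,finite} \<Rightarrow> nat" where
  "num_sol n z = card {xs :: 'a list. length xs = n \<and> (\<Sum>x\<leftarrow>xs. x ^ 3) = z}"

definition num_sol_gf :: "'a::{field,finite} \<Rightarrow> rat fps" where
  "num_sol_gf z = Abs_fps (\<lambda>n. if n = 0 then 0 else of_nat (num_sol n z))"

definition cd_rep :: "nat \<Rightarrow> nat \<Rightarrow> int \<Rightarrow> int \<Rightarrow> bool" where
  "cd_rep p q c d \<longleftrightarrow>
     4 * int q = c ^ 2 + 27 * d ^ 2 \<and> [c = 1] (mod 3) \<and>
     ([p = 1] (mod 3) \<longrightarrow> coprime c (int p))"

text \<open>
  The congruence \<open>9 d \<equiv> c (2 z\<^bsup>(q-1)/3\<^esup> + 1) (mod p)\<close> is read as an equality in the field,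
  which has characteristic \<open>p\<close>. If \<open>p \<equiv> 1 (mod 3)\<close>, the power of \<open>z\<close> lies in the prime field and
  this is the congruence of integers. If \<open>p \<equiv> 2 (mod 3)\<close> and \<open>z\<close> is non-cubic, that power is not
  in the prime field, but then \<open>p\<close> divides \<open>c\<close> and \<open>d = 0\<close>, so both sides vanish.
  It serves to fix the sign of \<open>d\<close> for non-cubic \<open>z\<close>. For cubic \<open>z\<close> and \<open>p \<equiv> 1 (mod 3)\<close> it would read
  \<open>9 d \<equiv> 3 c (mod p)\<close>, which together with \<^const>\<open>cd_rep\<close> is unsatisfiable.
\<close>

definition d_cong :: "'a::{field,finite} \<Rightarrow> int \<Rightarrow> int \<Rightarrow> bool" where
  "d_cong z c d \<longleftrightarrow>
     (of_int (9 * d) :: 'a) = of_int c * (2 * z ^ ((CARD('a) - 1) div 3) + 1)"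

end

theory Submission
  imports Defs
begin

text \<open>
  Let \<open>\<chi>\<close> be a cubic character of the field with \<open>q\<close> elements, so that \<open>\<chi>\<^sup>2\<close> is its conjugate, and
  put \<open>g = \<chi> + \<chi>\<^sup>2\<close>; then \<open>1 + g\<close> counts cube roots. As \<open>g\<close> sums to zero, the counting function
  \<open>A\<^sub>n\<close>, an \<open>n\<close>-fold additive convolution of \<open>1 + g\<close>, is \<open>q ^ (n - 1)\<close> plus the \<open>n\<close>-th convolution
  power of \<open>g\<close>. With the Jacobi sum \<open>J = \<Sum> \<chi>(y) \<chi>(1 - y)\<close> one has \<open>\<chi> * \<chi> = J \<chi>\<^sup>2\<close> and
  \<open>\<chi> * \<chi>\<^sup>2 = q \<delta> - 1\<close>; associativity then gives \<open>|J|\<^sup>2 = q\<close> and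
  \<open>g * g * g = 3 q g + c (q \<delta> - 1)\<close> with \<open>c = 2 Re J\<close>, which is the linear recurrence behind the
  generating function.

  Counting the \<open>y\<close> for which \<open>y (1 - y)\<close> lies in a given class modulo cubes yields \<open>J = a + b \<omega>\<close>
  with \<open>a \<equiv> 2\<close>, \<open>b \<equiv> 0 (mod 3)\<close>; so \<open>c = 2 a - b\<close> and \<open>d = b / 3\<close>. The sign of \<open>d\<close> and the
  coprimality of \<open>c\<close> and \<open>p\<close> come from the power sums of \<open>(y (1 - y)) ^ m\<close> and
  \<open>(y (1 - y)) ^ (2 m)\<close> over the field, where \<open>m = (q - 1) / 3\<close>: the first vanishes, the second is
  up to sign the binomial coefficient of \<open>2 m\<close> over \<open>m\<close>, which is prime to \<open>p\<close> if
  \<open>p \<equiv> 1 (mod 3)\<close>.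
\<close>

section \<open>Arithmetic of the form \<open>c\<^sup>2 + 27 d\<^sup>2\<close>\<close>

text \<open>The recursive form of Legendre's formula. From \<open>n\<close> to \<open>n + 1\<close>
  both sides grow by the multiplicity of \<open>n + 1\<close>: if
  \<open>n + 1 = p * (l + 1)\<close>, this is one plus the multiplicity of \<open>l + 1\<close>, the
  new factor of the smaller factorial.\<close>

lemma multiplicity_fact_div:
  fixes p :: nat
  assumes "prime p"
  shows "multiplicity p (fact n :: nat) = n div p + multiplicity p (fact (n div p) :: nat)"
proof (induction n)
  case (Suc n)
  have p: "p > 1" using assms prime_gt_1_nat by blast
  have pe: "prime_elem p" using assms by simp
  have step: "multiplicity p (fact (Suc m) :: nat) = multiplicity p (Suc m)
      + multiplicity p (fact m :: nat)" for m
    using pe by (simp add: prime_elem_multiplicity_mult_distrib del: mult_Suc)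
  show ?case
  proof (cases "p dvd Suc n")
    case True
    then obtain m where m: "Suc n = p * m" by auto
    then obtain l where l: "m = Suc l" by (cases m) auto
    have "n = l * p + (p - 1)" using m l p by (simp add: algebra_simps)
    then have nd: "n div p = l"
      using p by (intro div_nat_eqI) (auto simp: algebra_simps)
    have sd: "Suc n div p = Suc l" using m l p by (simp only: m) simp
    have "multiplicity p (Suc n) = 1 + multiplicity p (Suc l)"
      unfolding m l using pe p by (subst prime_elem_multiplicity_mult_distrib) auto
    then show ?thesis
      unfolding sd step Suc.IH nd by simp
  next
    case False
    then have "Suc n div p = n div p"
      by (simp add: div_Suc dvd_eq_mod_eq_0)
    moreover have "multiplicity p (Suc n) = 0"
      using False by (rule not_dvd_imp_multiplicity_0)
    ultimately show ?thesis unfolding step Suc.IH by simp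
  qed
qed simp

text \<open>All base \<open>p\<close> digits of \<open>m\<close> equal
  \<open>r = (p - 1) / 3\<close>. As \<open>2 * r < p\<close>, doubling \<open>m\<close> produces no
  carry, so Legendre's formula gives \<open>(2 * m)!\<close> exactly twice the valuation of
  \<open>m!\<close>.\<close>

lemma prime_not_dvd_third_binomial:
  fixes p k m :: nat
  assumes "prime p" "[p = 1] (mod 3)" "3 * m + 1 = p ^ k"
  shows "\<not> p dvd ((2 * m) choose m)"
proof -
  have pe: "prime_elem p" using assms by simp
  have p1: "p > 1" using assms prime_gt_1_nat by blast
  have e: "multiplicity p (fact (2 * m) :: nat) = 2 * multiplicity p (fact m :: nat)"
    using assms(3)
  proof (induction k arbitrary: m)
    case (Suc k)
    have "p = 3 * (p div 3) + 1" using assms(2) unfolding cong_def by presburger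
    then obtain r where r: "p = 3 * r + 1" by blast
    have "[p ^ k = 1] (mod 3)" using assms(2) cong_pow[of p 1 3 k] by simp
    then have "p ^ k = 3 * (p ^ k div 3) + 1" unfolding cong_def by presburger
    then obtain l where l: "p ^ k = 3 * l + 1" by blast
    have "3 * m + 1 = p * (3 * l + 1)" using Suc.prems l by simp
    then have m: "m = p * l + r" using r by (simp add: algebra_simps)
    have d1: "m div p = l" unfolding m using r by (intro div_nat_eqI) auto
    have "2 * m = p * (2 * l) + 2 * r" unfolding m by simp
    then have d2: "2 * m div p = 2 * l" using r by (intro div_nat_eqI) auto
    show ?case
      unfolding multiplicity_fact_div[OF assms(1), of m] multiplicity_fact_div[OF assms(1), of "2 * m"] d1 d2
      using Suc.IH[of l] l by simp
  qed simp
  have "fact m * fact (2 * m - m) * (2 * m choose m) = (fact (2 * m) :: nat)"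
    by (rule binomial_fact_lemma) simp
  then have "multiplicity p (fact (2 * m) :: nat) = multiplicity p (fact m * fact m * (2 * m choose m))"
    by simp
  also have "\<dots> = 2 * multiplicity p (fact m :: nat) + multiplicity p (2 * m choose m)"
    using pe by (simp add: prime_elem_multiplicity_mult_distrib)
  finally have "multiplicity p (2 * m choose m) = 0" using e by simp
  then show ?thesis
    using p1 by (simp add: multiplicity_eq_zero_iff)
qed

text \<open>The set splits into orbits of size three; the induction removes one orbit at a
  time.\<close>

lemma dvd3_card_of_fixpoint_free:
  assumes "finite S" "\<And>x. x \<in> S \<Longrightarrow> s x \<in> S"
      "\<And>x. x \<in> S \<Longrightarrow> s (s (s x)) = x"
    "\<And>x. x \<in> S \<Longrightarrow> s x \<noteq> x"
  shows "3 dvd card S"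
  using assms
proof (induction "card S" arbitrary: S rule: less_induct)
  case less
  show ?case
  proof (cases "S = {}")
    case False
    then obtain x where x: "x \<in> S" by auto
    let ?O = "{x, s x, s (s x)}"
    have O: "?O \<subseteq> S" using x less.prems by auto
    have c: "card ?O = 3"
      using x less.prems by (smt (verit) card_3_iff)
    have "3 dvd card (S - ?O)"
    proof (rule less.hyps)
      show "card (S - ?O) < card S"
        using less.prems(1) x by (intro psubset_card_mono) auto
      show "s y \<in> S - ?O" if "y \<in> S - ?O" for y
      proof -
        \<comment> \<open>If \<open>s y\<close> lay in the orbit of \<open>x\<close>, so would
          \<open>s (s (s y)) = y\<close>.\<close>
        have "s y \<in> S" "s (s (s y)) = y" "s (s (s x)) = x" using that x less.prems(2,3) by auto
        then show ?thesis using that by auto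
      qed
    qed (use less.prems in auto)
    moreover have "card S = card (S - ?O) + 3"
      using O c less.prems(1) by (metis card_Diff_subset card_mono finite_subset le_add_diff_inverse2)
    ultimately show ?thesis by simp
  qed simp
qed

section \<open>Uniqueness of the representation \<open>4 q = c^2 + 27 d^2\<close>\<close>

lemma eq_if_square_eq_cong_1_mod_3:
  fixes c c' :: int
  assumes "c ^ 2 = c' ^ 2" "[c = 1] (mod 3)" "[c' = 1] (mod 3)"
  shows "c = c'"
proof (rule ccontr)
  assume "c \<noteq> c'"
  then have "c = - c'" using assms(1) by (simp add: power2_eq_iff)
  then show False using assms(2,3) unfolding cong_def by presburger
qed

text \<open>With \<open>u = c d' - c' d\<close> and \<open>v = c d' + c' d\<close>, the product
  \<open>u v\<close> is \<open>4 q (d'^2 - d^2)\<close>. Since \<open>p\<close> cannot divide both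
  factors, \<open>q\<close> divides one of them; both are smaller than \<open>q\<close> in absolute
  value, so that one is zero.\<close>

lemma cd_rep_unique_split:
  assumes p: "prime p" "[p = 1] (mod 3)" and q: "q = p ^ k"
    and r: "cd_rep p q c d" "cd_rep p q c' d'"
  shows "c = c' \<and> d ^ 2 = d' ^ 2"
proof -
  have "p \<noteq> 2" using p(2) by (auto simp: cong_def)
  then have p0: "odd p" using p(1) prime_odd_nat[of p] prime_ge_2_nat[of p] by auto
  have pp: "prime (int p)" using p by simp
  have R: "4 * int q = c ^ 2 + 27 * d ^ 2" "4 * int q = c' ^ 2 + 27 * d' ^ 2"
    "coprime c (int p)" "coprime c' (int p)" "[c = 1] (mod 3)" "[c' = 1] (mod 3)"
    using r p unfolding cd_rep_def by auto
  have q0: "q > 0" using q p prime_gt_0_nat by auto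
  \<comment> \<open>This is \<open>u + v\<close> for the factors below. If \<open>p\<close> divided
    \<open>d'\<close>, it would divide \<open>c'\<close> as well.\<close>
  have nd: "\<not> int p dvd 2 * c * d'" if "k \<noteq> 0"
  proof
    assume "int p dvd 2 * c * d'"
    moreover have "\<not> int p dvd 2"
      using p0 p(1) by (metis of_nat_dvd_iff of_nat_numeral primes_dvd_imp_eq two_is_prime_nat)
    moreover have nc: "\<not> int p dvd c" "\<not> int p dvd c'" using R pp
      by (metis coprime_common_divisor dvd_refl not_prime_unit)+
    ultimately have d': "int p dvd d'" using pp by (metis prime_dvd_mult_iff)
    have "int p dvd int q" using q that by simp
    then have "int p dvd c' ^ 2 + 27 * d' ^ 2" using R(2) by (metis dvd_mult)
    then have "int p dvd c' ^ 2" using d'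
      by (metis dvd_add_left_iff dvd_mult power2_eq_square)
    then show False using nc pp prime_dvd_power by blast
  qed
  have d: "d ^ 2 = d' ^ 2"
  proof -
    let ?u = "c * d' - c' * d" and ?v = "c * d' + c' * d"
    have "?u * ?v = 4 * int q * (d' ^ 2 - d ^ 2)
        + d' ^ 2 * (c ^ 2 + 27 * d ^ 2 - 4 * int q) - d ^ 2 * (c' ^ 2 + 27 * d' ^ 2 - 4 * int q)"
      by (simp add: algebra_simps power2_eq_square)
    then have uv: "?u * ?v = 4 * int q * (d' ^ 2 - d ^ 2)" unfolding R(1)[symmetric] R(2)[symmetric] by simp
    then have qd: "int p ^ k dvd ?u * ?v" using q by (simp add: uv)
    have zero: "t = 0" if "int q dvd t" "27 * t ^ 2 \<le> 16 * int q ^ 2" for t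
    proof (rule ccontr)
      assume "t \<noteq> 0"
      then have "\<bar>int q\<bar> \<le> \<bar>t\<bar>" using that(1) by (rule dvd_imp_le_int)
      then have "int q ^ 2 \<le> t ^ 2" using abs_le_square_iff by blast
      moreover have "int q ^ 2 > 0" using q0 by simp
      ultimately show False using that(2) by linarith
    qed
    have i1: "27 * ?u ^ 2 \<le> 16 * int q ^ 2"
    proof -
      \<comment> \<open>Brahmagupta's identity for the form \<open>x^2 + 27 y^2\<close>; the bound
        follows by dropping the first square. Changing the sign of \<open>d'\<close> gives the one
        for \<open>v\<close>.\<close>
      have "(4 * int q) * (4 * int q) = (c * c' + 27 * d * d') ^ 2 + 27 * ?u ^ 2"
        by (subst R(1), subst R(2)) (simp add: algebra_simps power2_eq_square)
      then show ?thesis by (simp add: power2_eq_square)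
    qed
    have i2: "27 * ?v ^ 2 \<le> 16 * int q ^ 2"
    proof -
      have "(4 * int q) * (4 * int q) = (c * c' - 27 * d * d') ^ 2 + 27 * ?v ^ 2"
        by (subst R(1), subst R(2)) (simp add: algebra_simps power2_eq_square)
      then show ?thesis by (simp add: power2_eq_square)
    qed
    have "int q dvd ?u \<or> int q dvd ?v"
    proof (cases "k = 0")
      case False
      have "\<not> (int p dvd ?u \<and> int p dvd ?v)"
      proof
        assume "int p dvd ?u \<and> int p dvd ?v"
        then have "int p dvd ?u + ?v" by (simp only: dvd_add)
        then show False using nd[OF False] by (simp add: mult.assoc)
      qed
      then have "coprime (int p ^ k) ?u \<or> coprime (int p ^ k) ?v"
        using pp by (meson coprime_power_left_iff prime_imp_coprime)
      then show ?thesis using qd q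
        by (metis coprime_dvd_mult_left_iff coprime_dvd_mult_right_iff of_nat_power)
    qed (use q in simp)
    then have "?u = 0 \<or> ?v = 0" using zero i1 i2 by blast
    then have "4 * int q * (d' ^ 2 - d ^ 2) = 0" using uv by auto
    then show ?thesis using q0 by simp
  qed
  then have "c ^ 2 = c' ^ 2" using R(1,2) by simp
  then show ?thesis using d eq_if_square_eq_cong_1_mod_3 R by blast
qed

text \<open>Otherwise \<open>-3\<close> would be the square of \<open>c / (3 d)\<close> modulo
  \<open>p\<close>, which produces a primitive cube root of unity modulo \<open>p\<close>. There is
  none, because 3 does not divide \<open>p - 1\<close>.\<close>

lemma prime_dvd_sq_plus_27_sq:
  fixes c d :: int and p :: nat
  assumes p: "prime p" "[p = 2] (mod 3)" "odd p" and dv: "int p dvd c ^ 2 + 27 * d ^ 2"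
  shows "int p dvd d"
proof (rule ccontr)
  assume nd: "\<not> int p dvd d"
  have pp: "prime (int p)" using p by simp
  have p3: "p \<noteq> 3" using p(2) by (auto simp: cong_def)
  have "\<not> int p dvd 6"
  proof
    assume "int p dvd 6"
    then have "int p dvd 2 * 3" by simp
    then have "int p dvd 2 \<or> int p dvd 3" using pp prime_dvd_mult_iff by blast
    then have "p dvd 2 \<or> p dvd 3" by (metis of_nat_dvd_iff of_nat_numeral)
    moreover have "prime (3::nat)" by simp
    ultimately show False using p p3 by (metis primes_dvd_imp_eq two_is_prime_nat)
  qed
  then have "\<not> int p dvd 6 * d" using nd pp prime_dvd_mult_iff by blast
  then have "coprime (6 * d) (int p)" using pp by (metis coprime_commute prime_imp_coprime)
  then obtain e where e: "[6 * d * e = 1] (mod int p)"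
    using cong_solve_coprime_int by blast
  \<comment> \<open>\<open>u\<close> represents \<open>(c / (3 d) - 1) / 2\<close>, a primitive cube root of unity modulo \<open>p\<close>\<close>
  define u where "u = e * (c - 3 * d)"
  obtain t where t: "6 * d * e = 1 + int p * t"
    using e by (metis cong_iff_lin cong_sym)
  obtain s where s: "c ^ 2 + 27 * d ^ 2 = int p * s" using dv by auto
  have "u ^ 2 + u + 1 = int p * (e ^ 2 * s - t * (3 * d * e + 1) - t * c * e)"
  proof -
    \<comment> \<open>An exact identity over the integers. Both terms on the right are multiples of
      \<open>p\<close>, the second because \<open>e\<close> inverts \<open>6 d\<close>.\<close>
    have "u ^ 2 + u + 1 = e ^ 2 * (c ^ 2 + 27 * d ^ 2) - (6 * d * e - 1) * (3 * d * e + 1 + c * e)"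
      unfolding u_def by (simp add: algebra_simps power2_eq_square)
    also have "\<dots> = e ^ 2 * (int p * s) - int p * t * (3 * d * e + 1 + c * e)"
      unfolding t s by simp
    finally show ?thesis by (simp add: algebra_simps power2_eq_square)
  qed
  then have u: "[u ^ 2 + u + 1 = 0] (mod int p)" by (simp add: cong_0_iff)
  have "u ^ 3 - 1 = (u - 1) * (u ^ 2 + u + 1)"
    by (simp add: algebra_simps power2_eq_square power3_eq_cube)
  then have u3: "[u ^ 3 = 1] (mod int p)" using u
    by (metis cong_0_iff cong_iff_dvd_diff dvd_mult)
  have "\<not> int p dvd u"
  proof
    assume "int p dvd u"
    then have "int p dvd u ^ 2 + u" by (simp add: power2_eq_square)
    then have "int p dvd 1" using u by (metis cong_0_iff dvd_add_right_iff)
    then show False using pp by simp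
  qed
  define v where "v = nat (u mod int p)"
  have v: "[int v = u] (mod int p)"
    using prime_gt_0_nat[OF p(1)] by (simp add: v_def)
  then have "\<not> p dvd v" using \<open>\<not> int p dvd u\<close> cong_dvd_iff[OF v] by simp
  then have "[v ^ (p - 1) = 1] (mod p)" using p(1) fermat_theorem by blast
  then have "[int v ^ (p - 1) = 1] (mod int p)" by (metis cong_int_iff of_nat_1 of_nat_power)
  then have "[u ^ (p - 1) = 1] (mod int p)" using v by (meson cong_pow cong_sym cong_trans)
  \<comment> \<open>As \<open>p - 1 = 3 m + 1\<close>, Fermat's theorem and \<open>u^3 = 1\<close>
    give \<open>u = 1\<close>; then \<open>u^2 + u + 1\<close> is 3, which would have to vanish
    modulo \<open>p\<close>.\<close>
  moreover have "p mod 3 = 2" using p(2) by (simp add: cong_def)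
  then have "p = 3 * (p div 3) + 2" by presburger
  then obtain m where "p = 3 * m + 2" by blast
  then have m: "p - 1 = 3 * m + 1" by simp
  ultimately have "[(u ^ 3) ^ m * u = 1] (mod int p)"
    by (simp only: m power_add power_mult power_one_right)
  moreover have "[(u ^ 3) ^ m * u = 1 ^ m * u] (mod int p)"
    using u3 by (intro cong_mult cong_pow cong_refl)
  ultimately have "[u = 1] (mod int p)" by (metis cong_sym cong_trans power_one mult_1)
  then have "[u ^ 2 + u + 1 = 1 ^ 2 + 1 + 1] (mod int p)"
    by (intro cong_add cong_pow cong_refl)
  then have "[(3::int) = 0] (mod int p)" using u
    by (metis cong_sym cong_trans one_add_one one_power2 numeral_plus_one semiring_norm(5))
  then have "p dvd 3" by (metis cong_0_iff of_nat_dvd_iff of_nat_numeral)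
  moreover have "prime (3::nat)" by simp
  ultimately show False using p3 p(1) primes_dvd_imp_eq by blast
qed

text \<open>Descent on \<open>j\<close>: \<open>p\<close> divides both \<open>c\<close> and
  \<open>d\<close>, so a factor \<open>p^2\<close> cancels. At the bottom
  \<open>4 = c^2 + 27 d^2\<close> leaves only \<open>d = 0\<close>.\<close>

lemma inert_norm_form_trivial:
  fixes c d :: int and p :: nat
  assumes "prime p" "[p = 2] (mod 3)" "4 * int p ^ (2 * j) = c ^ 2 + 27 * d ^ 2"
  shows "d = 0"
  using assms(3)
proof (induction j arbitrary: c d)
  case 0
  have "d ^ 2 = 0"
  proof (rule ccontr)
    assume "d ^ 2 \<noteq> 0"
    then have "d ^ 2 \<ge> 1" by (smt (verit) zero_le_power2)
    then show False using 0 by (smt (verit) zero_le_power2 mult_0_right power_0)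
  qed
  then show ?case by simp
next
  case (Suc j)
  have pe: "4 * int p ^ (2 * Suc j) = int p ^ 2 * (4 * int p ^ (2 * j))"
    by (simp add: power2_eq_square)
  have pp: "prime (int p)" using assms(1) by simp
  have "int p dvd c \<and> int p dvd d"
  proof (cases "odd p")
    case True
    have "int p dvd c ^ 2 + 27 * d ^ 2" unfolding Suc.prems[symmetric] by simp
    then have d: "int p dvd d" using prime_dvd_sq_plus_27_sq assms True by blast
    then have "int p dvd c ^ 2" using \<open>int p dvd c ^ 2 + 27 * d ^ 2\<close>
      by (metis dvd_add_left_iff dvd_mult power2_eq_square)
    then show ?thesis using d pp prime_dvd_power by blast
  next
    case False
    then have p2: "p = 2" using assms(1) prime_odd_nat[of p] prime_ge_2_nat[of p] by force
    have e: "16 * (2 ^ (2 * j)) = c ^ 2 + 27 * d ^ 2" using Suc.prems p2 by simp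
    then have ev: "even c \<longleftrightarrow> even d"
      by (metis even_add even_mult_iff even_numeral even_power odd_numeral pos2)
    \<comment> \<open>Odd squares are 1 modulo 8, so for odd \<open>c\<close> and \<open>d\<close>
      the right-hand side is 28, hence 4, modulo 8, while the left-hand side is a multiple of
      16.\<close>
    have "\<not> odd c"
    proof
      assume "odd c"
      then obtain a b where ab: "c = 2 * a + 1" "d = 2 * b + 1" using ev by (metis oddE)
      obtain a' b' where "a * (a + 1) = 2 * a'" "b * (b + 1) = 2 * b'"
        by (metis dvdE even_mult_iff even_plus_one_iff)
      then have "8 * (2 * 2 ^ (2 * j) - a' - 27 * b' - 3) = 4"
        using e unfolding ab by (simp add: power2_eq_square algebra_simps)
      then have "8 dvd (4 :: int)" by (metis dvd_triv_left)
      then show False by simp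
    qed
    then show ?thesis using ev p2 by simp
  qed
  then obtain c' d' where cd: "c = int p * c'" "d = int p * d'" by (auto elim!: dvdE)
  have "int p ^ 2 * (4 * int p ^ (2 * j)) = int p ^ 2 * (c' ^ 2 + 27 * d' ^ 2)"
    using Suc.prems unfolding pe cd by (simp add: algebra_simps power_mult_distrib)
  then have "4 * int p ^ (2 * j) = c' ^ 2 + 27 * d' ^ 2"
    using pp by (simp add: power2_eq_square)
  then show ?case using Suc.IH cd by simp
qed

text \<open>Since \<open>p\<close> is \<open>-1\<close> modulo 3 and \<open>p ^ k\<close> is 1, the
  exponent is even, and the descent applies.\<close>

lemma cd_rep_inert:
  assumes p: "prime p" "[p = 2] (mod 3)" and q: "q = p ^ k" "[q = 1] (mod 3)"
    and r: "cd_rep p q c d"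
  shows "d = 0"
proof -
  have "even k"
  proof (rule ccontr)
    assume "odd k"
    then obtain j where "k = 2 * j + 1" by (auto elim: oddE)
    then have "q = (p ^ 2) ^ j * p" using q by (simp add: power_mult)
    moreover have "[(p ^ 2) ^ j * p = (2 ^ 2) ^ j * 2] (mod 3)"
      using p by (intro cong_mult cong_pow)
    moreover have "[((2::nat) ^ 2) ^ j * 2 = 1 ^ j * 2] (mod 3)"
      by (intro cong_mult cong_pow) (auto simp: cong_def)
    ultimately have "[1 = 2::nat] (mod 3)" using q
      by (metis cong_sym cong_trans power_one mult_1)
    then show False by (simp add: cong_def)
  qed
  then obtain j where "k = 2 * j" by auto
  then show ?thesis
    using inert_norm_form_trivial[OF p, of j c d] r q by (simp add: cd_rep_def)
qed

section \<open>Convolution and power sums on a finite field\<close>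

definition conv :: "('a::{ab_group_add,finite} \<Rightarrow> 'b::comm_ring_1) \<Rightarrow> ('a \<Rightarrow> 'b) \<Rightarrow> 'a \<Rightarrow> 'b" where
  "conv u v z = (\<Sum>y\<in>UNIV. u y * v (z - y))"

lemma conv_commute: "conv u v = conv v u"
proof
  fix z
  show "conv u v z = conv v u z"
    unfolding conv_def
    by (rule sum.reindex_bij_witness[of _ "\<lambda>y. z - y" "\<lambda>y. z - y"]) (auto simp: mult.commute)
qed

lemma conv_assoc: "conv (conv u v) t = conv u (conv v t)"
proof
  fix z
  have "conv (conv u v) t z = (\<Sum>y\<in>UNIV. \<Sum>x\<in>UNIV. u x * (v (y - x) * t (z - y)))"
    by (simp add: conv_def sum_distrib_right mult.assoc)
  also have "\<dots> = (\<Sum>x\<in>UNIV. u x * (\<Sum>y\<in>UNIV. v (y - x) * t (z - y)))"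
    by (subst sum.swap) (simp add: sum_distrib_left)
  also have "\<dots> = conv u (conv v t) z"
  proof -
    have "(\<Sum>y\<in>UNIV. v (y - x) * t (z - y)) = conv v t (z - x)" for x
      unfolding conv_def
      by (rule sum.reindex_bij_witness[of _ "\<lambda>s. s
          + x" "\<lambda>y. y - x"]) (auto simp: algebra_simps)
    then show ?thesis by (simp add: conv_def[of u])
  qed
  finally show "conv (conv u v) t z = conv u (conv v t) z" .
qed

lemma conv_add_left: "conv (\<lambda>x. u x + v x) t z = conv u t z + conv v t z"
  by (simp add: conv_def distrib_right sum.distrib)

lemma conv_add_right: "conv t (\<lambda>x. u x + v x) z = conv t u z + conv t v z"
  by (simp add: conv_def distrib_left sum.distrib)

lemma conv_scale_left: "conv (\<lambda>x. a * u x) t z = a * conv u t z"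
  by (simp add: conv_def sum_distrib_left mult.assoc)

lemma conv_const_left: "conv (\<lambda>x. a) t z = a * sum t UNIV"
  unfolding conv_def sum_distrib_left
  by (rule sum.reindex_bij_witness[of _ "\<lambda>y. z - y" "\<lambda>y. z - y"]) auto

lemma conv_delta_left: "conv (\<lambda>x. if x = 0 then 1 else 0) t z = t z"
proof -
  have "conv (\<lambda>x. if x = 0 then 1 else 0) t z = (\<Sum>y\<in>UNIV. if y = 0 then t (z - y) else 0)"
    unfolding conv_def by (intro sum.cong) auto
  then show ?thesis by simp
qed

lemma sum_conv: "sum (conv u v) UNIV = sum u UNIV * sum v UNIV"
proof -
  have "sum (conv u v) UNIV = (\<Sum>y\<in>UNIV. u y * (\<Sum>z\<in>UNIV. v (z - y)))"
    unfolding conv_def by (subst sum.swap) (simp add: sum_distrib_left)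
  moreover have "(\<Sum>z\<in>UNIV. v (z - y)) = sum v UNIV" for y
    by (rule sum.reindex_bij_witness[of _ "\<lambda>s. s + y" "\<lambda>z. z - y"]) auto
  ultimately show ?thesis by (simp add: sum_distrib_right)
qed

section \<open>Power sums over a finite field and the criterion for cubes\<close>

lemma card_field_ge_2: "CARD('a::{field,finite}) \<ge> 2"
proof -
  have "card {0, 1 :: 'a} \<le> CARD('a)" by (intro card_mono) auto
  then show ?thesis by simp
qed

text \<open>Multiplication by \<open>y\<close> permutes the nonzero elements, so it fixes their
  product.\<close>

lemma power_card_minus_1:
  fixes y :: "'a::{field,finite}"
  assumes "y \<noteq> 0"
  shows "y ^ (CARD('a) - 1) = 1"
proof -
  have "(\<Prod>x\<in>UNIV-{0}. y * x) = (\<Prod>x\<in>UNIV-{0}. x)"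
    by (rule prod.reindex_bij_witness[of _ "\<lambda>x. x / y" "\<lambda>x. y * x"]) (use assms in auto)
  moreover have "(\<Prod>x\<in>UNIV-{0}. y * x) = y ^ (CARD('a) - 1) * (\<Prod>x\<in>UNIV-{0}. x)"
    by (simp add: prod.distrib)
  ultimately show ?thesis by simp
qed

lemma card_nth_roots_le:
  fixes a :: "'a::{field,finite}"
  assumes "m > 0"
  shows "card {y. y ^ m = a} \<le> m"
proof -
  let ?P = "monom 1 m - [:a:]"
  have "coeff ?P m = 1" using assms by (cases m) (auto simp: coeff_pCons)
  then have "?P \<noteq> 0" by force
  then have "card {y. poly ?P y = 0} \<le> degree ?P" by (rule card_poly_roots_bound)
  also have "degree ?P \<le> m" by (intro degree_diff_le) (auto simp: degree_monom_le)
  finally show ?thesis by (simp add: poly_monom)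
qed

text \<open>Scaling the variable by \<open>g\<close> multiplies the sum by \<open>g ^ m\<close>.
  Some \<open>g\<close> has \<open>g ^ m \<noteq> 1\<close>: with \<open>r\<close> the residue of
  \<open>m\<close> modulo \<open>q - 1\<close>, the equation \<open>y ^ r = 1\<close> has at most
  \<open>r < q - 1\<close> roots.\<close>

lemma sum_power_eq_0:
  assumes "\<not> (CARD('a::{field,finite}) - 1) dvd m"
  shows "(\<Sum>y\<in>UNIV. y ^ m) = (0 :: 'a)"
proof -
  let ?n = "CARD('a) - 1"
  define r where "r = m mod ?n"
  have n: "?n > 0" using card_field_ge_2[where 'a='a] by simp
  have r: "0 < r" "r < ?n" using assms n by (auto simp: r_def dvd_eq_mod_eq_0)
  have "\<exists>g::'a. g \<noteq> 0 \<and> g ^ r \<noteq> 1"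
  proof (rule ccontr)
    assume "\<not> ?thesis"
    then have "UNIV - {0} \<subseteq> {y::'a. y ^ r = 1}" by auto
    then have "card (UNIV - {0::'a}) \<le> card {y::'a. y ^ r = 1}" by (intro card_mono) auto
    also have "\<dots> \<le> r" using r card_nth_roots_le by blast
    finally show False using r by simp
  qed
  then obtain g :: 'a where g: "g \<noteq> 0" "g ^ r \<noteq> 1" by blast
  have "g ^ m = g ^ (?n * (m div ?n) + r)" by (simp add: r_def)
  also have "\<dots> = g ^ r" by (simp only: power_add power_mult power_card_minus_1[OF g(1)] power_one mult_1)
  finally have gm: "g ^ m \<noteq> 1" using g by simp
  have "(\<Sum>y\<in>UNIV. (g * y) ^ m) = (\<Sum>y\<in>UNIV. y ^ m)"
    by (rule sum.reindex_bij_witness[of _ "\<lambda>x. x / g" "\<lambda>x. g * x"]) (use g in auto)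
  then have "(g ^ m - 1) * (\<Sum>y\<in>UNIV. y ^ m) = 0"
    by (simp add: power_mult_distrib left_diff_distrib flip: sum_distrib_left)
  then show ?thesis using gm by simp
qed

lemma of_nat_card_field: "of_nat CARD('a::{field,finite}) = (0::'a)"
  by (simp add: of_nat_eq_0_iff_char_dvd CHAR_dvd_CARD)

lemma sum_power_card_minus_1:
  "(\<Sum>y\<in>UNIV. y ^ (CARD('a::{field,finite}) - 1)) = (- 1 :: 'a)"
proof -
  have n: "CARD('a) - 1 > 0" using card_field_ge_2[where 'a='a] by simp
  have "(\<Sum>y\<in>(UNIV :: 'a set). y ^ (CARD('a) - 1))
      = (\<Sum>y\<in>(UNIV :: 'a set). 1 - (if y = 0 then 1 else 0))"
    using n by (intro sum.cong) (auto simp: power_card_minus_1 simp del: One_nat_def)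
  also have "\<dots> = of_nat CARD('a) - 1" by (simp add: sum_subtractf)
  finally show ?thesis by (simp add: of_nat_card_field)
qed

lemma sum_power_times_one_minus:
  "(\<Sum>y\<in>UNIV. (y * (1 - y)) ^ m) =
    (\<Sum>j\<le>m. of_nat (m choose j) * (- 1) ^ j * (\<Sum>y\<in>UNIV. y ^ (m + j) :: 'a::{field,finite}))"
proof -
  have "(y * (1 - y)) ^ m = (\<Sum>j\<le>m. of_nat (m choose j) * (- 1) ^ j * y ^ (m + j))" for y :: 'a
  proof -
    have "(1 - y) ^ m = (\<Sum>j\<le>m. of_nat (m choose j) * (- y) ^ j * 1 ^ (m - j))"
      using binomial_ring[of "- y" 1 m] by simp
    then have "(y * (1 - y)) ^ m = y ^ m * (\<Sum>j\<le>m. of_nat (m choose j) * (- y) ^ j)"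
      by (simp add: power_mult_distrib)
    also have "\<dots> = (\<Sum>j\<le>m. of_nat (m choose j) * (- 1) ^ j * y ^ (m + j))"
      unfolding sum_distrib_left
      by (intro sum.cong) (auto simp: power_add power_minus[of y] mult_ac)
    finally show ?thesis .
  qed
  then have "(\<Sum>y\<in>UNIV. (y * (1 - y)) ^ m) =
      (\<Sum>y\<in>UNIV. \<Sum>j\<le>m. of_nat (m choose j) * (- 1) ^ j * (y ^ (m + j) :: 'a))" by simp
  also have "\<dots> = (\<Sum>j\<le>m. of_nat (m choose j) * (- 1) ^ j * (\<Sum>y\<in>UNIV. y ^ (m + j)))"
    by (subst sum.swap) (simp add: sum_distrib_left)
  finally show ?thesis .
qed

text \<open>Nonzero cubes are among the at most \<open>m\<close> roots of \<open>y ^ m = 1\<close>.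
  Cubing is at most three-to-one on \<open>3 * m\<close> nonzero elements, so there are at least
  \<open>m\<close> cubes and the two sets agree.\<close>

lemma cubic_iff_power_eq_1:
  fixes y :: "'a::{field,finite}"
  assumes q: "CARD('a) = 3 * m + 1" and "y \<noteq> 0"
  shows "cubic y \<longleftrightarrow> y ^ m = 1"
proof -
  let ?H = "(\<lambda>x. x ^ 3) ` (UNIV - {0::'a})" and ?R = "{y::'a. y ^ m = 1}"
  have m: "m > 0" using q card_field_ge_2[where 'a='a] by simp
  have "?H \<subseteq> ?R" using power_card_minus_1[where 'a='a] q by (auto simp flip: power_mult)
  moreover have "card ?R \<le> card ?H"
  proof -
    have "3 * m = card (UNIV - {0::'a})" using q by simp
    also have "UNIV - {0::'a} = (\<Union>h\<in>?H. {x. x \<noteq> 0 \<and> x ^ 3 = h})" by auto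
    also have "card \<dots> \<le> (\<Sum>h\<in>?H. card {x. x \<noteq> 0 \<and> x ^ 3 = h})"
        by (rule card_UN_le) simp
    also have "\<dots> \<le> (\<Sum>h\<in>?H. 3)"
    proof (rule sum_mono)
      fix h :: 'a
      have "card {x. x \<noteq> 0 \<and> x ^ 3 = h} \<le> card {x. x ^ 3 = h}" by (intro card_mono) auto
      also have "\<dots> \<le> 3" by (rule card_nth_roots_le) simp
      finally show "card {x. x \<noteq> 0 \<and> x ^ 3 = h} \<le> 3" .
    qed
    finally have "m \<le> card ?H" by simp
    moreover have "card ?R \<le> m" using m by (rule card_nth_roots_le)
    ultimately show ?thesis by simp
  qed
  ultimately have "?H = ?R" by (intro card_seteq) auto
  then have "y \<in> ?H \<longleftrightarrow> y \<in> ?R" by simp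
  then show ?thesis by (auto simp: cubic_def)
qed

section \<open>Recursion for the number of solutions and a rational generating function\<close>

lemma num_sol_Suc: "num_sol (Suc n) z = (\<Sum>x\<in>UNIV. num_sol n (z - x ^ 3))"
proof -
  let ?A = "\<lambda>x. {xs. length xs = n \<and> (\<Sum>x\<leftarrow>xs. x ^ 3) = z - x ^ 3}"
  have fin: "finite (?A x)" for x
    using finite_lists_length_eq[of "UNIV::'a set" n] by (rule rev_finite_subset) auto
  have "{xs. length xs = Suc n \<and> (\<Sum>x\<leftarrow>xs. x ^ 3) = z}
      = (\<Union>x\<in>UNIV. (#) x ` ?A x)"
    by (auto simp: length_Suc_conv algebra_simps image_iff)
  then have "num_sol (Suc n) z = card (\<Union>x\<in>UNIV. (#) x ` ?A x)"
    by (simp add: num_sol_def)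
  also have "\<dots> = (\<Sum>x\<in>UNIV. card ((#) x ` ?A x))"
    by (rule card_UN_disjoint) (auto simp: fin)
  also have "\<dots> = (\<Sum>x\<in>UNIV. card (?A x))"
    by (intro sum.cong refl card_image) auto
  finally show ?thesis by (simp add: num_sol_def)
qed

text \<open>The first coordinate is grouped by the value of its cube.\<close>

lemma num_sol_Suc_conv:
  "of_nat (num_sol (Suc n) z) = conv (\<lambda>y. of_nat (card {x. x ^ 3 = y})) (\<lambda>y. of_nat (num_sol n y)) z"
proof -
  have "num_sol (Suc n) z = (\<Sum>x\<in>UNIV. num_sol n (z - x ^ 3))" by (rule num_sol_Suc)
  also have "\<dots> = (\<Sum>y\<in>UNIV. \<Sum>x\<in>{x\<in>UNIV. x ^ 3 = y}. num_sol n (z - x ^ 3))"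
    by (rule sum.group[symmetric]) auto
  also have "\<dots> = (\<Sum>y\<in>UNIV. card {x. x ^ 3 = y} * num_sol n (z - y))"
    by (intro sum.cong) auto
  finally show ?thesis by (simp add: conv_def)
qed

text \<open>Multiplying by the denominators leaves finitely many coefficients, since the recurrence
  kills all those beyond index 3.\<close>

lemma rational_gf:
  fixes B :: "nat \<Rightarrow> rat" and q c :: rat
  assumes rec: "\<And>n. n \<ge> 1 \<Longrightarrow> B (n + 3) = 3 * q * B (n + 1) + q * c * B n"
  shows "Abs_fps (\<lambda>n. if n = 0 then 0 else q ^ (n - 1) + B n) =
     fps_X / (1 - fps_const q * fps_X) +
     (fps_const (B 1) * fps_X + fps_const (B 2) * fps_X ^ 2 + fps_const (B 3 - 3 * q * B 1) * fps_X ^ 3) /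
     (1 - 3 * fps_const q * fps_X ^ 2 - fps_const q * fps_const c * fps_X ^ 3)"
proof -
  let ?U = "Abs_fps (\<lambda>n. if n = 0 then 0 else q ^ (n - 1))"
  let ?V = "Abs_fps (\<lambda>n. if n = 0 then 0 else B n)"
  let ?D = "1 - 3 * fps_const q * fps_X ^ 2 - fps_const q * fps_const c * fps_X ^ 3 :: rat fps"
  let ?E = "1 - fps_const q * fps_X :: rat fps"
  let ?N = "fps_const (B 1) * fps_X + fps_const (B 2) * fps_X ^ 2 + fps_const (B 3 - 3 * q * B 1) * fps_X ^ 3"
  have E: "?E \<noteq> 0"
  proof
    assume "?E = 0"
    then have "fps_nth ?E 0 = 0" by (simp only: fps_zero_nth)
    then show False by simp
  qed
  have D: "?D = 1 - fps_const (3 * q) * fps_X ^ 2 - fps_const (q * c) * fps_X ^ 3"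
    by (simp add: numeral_fps_const)
  have D0: "?D \<noteq> 0"
  proof
    assume "?D = 0"
    then have "fps_nth ?D 0 = 0" by (simp only: fps_zero_nth)
    then show False unfolding D by (simp add: fps_sub_nth)
  qed
  have UE: "?U * ?E = fps_X"
  proof (rule fps_ext)
    fix n
    have "fps_nth (?U * ?E) n = fps_nth (?U - fps_const q * (?U * fps_X)) n"
      by (simp add: algebra_simps)
    also have "\<dots> = fps_nth fps_X n"
      by (cases n; cases "n - 1") auto
    finally show "fps_nth (?U * ?E) n = fps_nth fps_X n" .
  qed
  have U: "fps_X / ?E = ?U"
    using nonzero_mult_div_cancel_right[OF E, of ?U] unfolding UE .
  have VD: "?V * ?D = ?N"
  proof (rule fps_ext)
    fix n
    have "fps_nth (?V * ?D) n = fps_nth (?V - fps_const (3 * q) * (?V * fps_X ^ 2)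
        - fps_const (q * c) * (?V * fps_X ^ 3)) n"
      unfolding D by (simp add: algebra_simps)
    also have "\<dots> = fps_nth ?N n"
    proof -
      \<comment> \<open>Index 3 stands apart: the series has constant term 0 in place of
        \<open>B 0\<close>, so the coefficient there is \<open>B 3 - 3 * q * B 1\<close>.\<close>
      have "n = 0 \<or> n = 1 \<or> n = 2 \<or> n = 3 \<or> (n = (n - 3) + 3 \<and> n - 3 \<ge> 1)" by arith
      then consider "n = 0" | "n = 1" | "n = 2" | "n = 3" | k where "n = k + 3" "k \<ge> 1" by blast
      then show ?thesis
      proof cases
        case 5
        then have "n - 2 = k + 1" "n - 3 = k" by auto
        then show ?thesis using rec[of k] 5 by (simp add: fps_X_power_mult_right_nth)
      qed (auto simp: fps_X_power_mult_right_nth)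
    qed
    finally show "fps_nth (?V * ?D) n = fps_nth ?N n" .
  qed
  have V: "?N / ?D = ?V"
    using nonzero_mult_div_cancel_right[OF D0, of ?V] unfolding VD .
  show ?thesis unfolding U V by (rule fps_ext) simp
qed

section \<open>The cubic character and its Jacobi sum\<close>

text \<open>The primitive cube root of unity \<open>exp (2 pi i / 3)\<close>, in rectangular form so
  that its relations follow by comparing coordinates.\<close>

definition cis3 :: complex where "cis3 = Complex (- 1 / 2) (sqrt 3 / 2)"

lemma cis3_sq: "cis3 * cis3 = cnj cis3"
  by (simp add: cis3_def complex_eq_iff)

lemma cis3_cnj: "cis3 * cnj cis3 = 1"
  by (simp add: cis3_def complex_eq_iff)

lemma cis3_add_cnj: "cis3 + cnj cis3 = -1"
  by (simp add: cis3_def complex_eq_iff)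

lemma cnj_cis3: "cnj cis3 = - 1 - cis3"
  using cis3_add_cnj by (simp add: algebra_simps eq_neg_iff_add_eq_0)

lemma cis3_neq_1: "cis3 \<noteq> 1"
  by (simp add: cis3_def complex_eq_iff)

text \<open>The noncube \<open>z0\<close> selects one of the two conjugate cubic characters, the one
  with \<open>chi z0 = cis3\<close>. Taking \<open>z0 = z\<close> later ties the sign of
  \<open>d\<close> to \<open>z\<close>.\<close>

locale cubic_character =
  fixes z0 :: "'a::{field,finite}" and m :: nat
  assumes card_eq: "CARD('a) = 3 * m + 1" and z0: "z0 \<noteq> 0" "z0 ^ m \<noteq> 1"
begin

definition w :: 'a where "w = z0 ^ m"

lemma m_pos: "m > 0"
  using card_eq card_field_ge_2[where 'a='a] by simp

lemma zero_power_m: "0 ^ m = (0::'a)"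
  using m_pos by simp

lemma power_m_cube: "y \<noteq> 0 \<Longrightarrow> (y ^ m) ^ 3 = (1::'a)"
  using power_card_minus_1[of y] card_eq by (simp add: mult.commute flip: power_mult)

lemma w_neq_1: "w \<noteq> 1" and w_neq_0: "w \<noteq> 0"
  using z0 by (auto simp: w_def)

lemma w_sq: "w * w = - 1 - w"
proof -
  have "(w - 1) * (w * w + w + 1) = w ^ 3 - 1" by (simp add: algebra_simps power3_eq_cube)
  also have "\<dots> = 0" using power_m_cube[OF z0(1)] by (simp add: w_def)
  finally have "w * w + w + 1 = 0" using w_neq_1 by simp
  then show ?thesis by (simp add: algebra_simps eq_neg_iff_add_eq_0)
qed

lemma w_cube: "w * (w * w) = 1"
  using power_m_cube[OF z0(1)] by (simp add: w_def power3_eq_cube mult.assoc)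

lemma w_sq_neq: "w * w \<noteq> 1" "w * w \<noteq> w" "w * w \<noteq> 0"
proof -
  show "w * w \<noteq> w" "w * w \<noteq> 0" using w_neq_0 w_neq_1 by auto
  show "w * w \<noteq> 1" using w_cube w_neq_1 by auto
qed

lemma three_neq_0: "(3::'a) \<noteq> 0"
proof
  assume "(3::'a) = 0"
  have "of_nat (3 * m + 1) = (0::'a)" using of_nat_card_field[where 'a='a] card_eq by simp
  then show False using \<open>(3::'a) = 0\<close> by simp
qed

lemma cube_roots_of_unity: "v ^ 3 = 1 \<Longrightarrow> v = 1 \<or> v = w \<or> v = w * w"
proof -
  assume v: "v ^ 3 = 1"
  have "(v - 1) * ((v - w) * (v - w * w)) = v ^ 3 - 1"
  proof -
    have "(v - w) * (v - w * w) = v * v + v + 1"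
      using w_cube by (simp add: algebra_simps w_sq)
    then show ?thesis by (simp add: algebra_simps power3_eq_cube)
  qed
  then show ?thesis using v by auto
qed

lemma power_m_cases: "y ^ m = 0 \<or> y ^ m = 1 \<or> y ^ m = w \<or> y ^ m = w * w"
  using cube_roots_of_unity[OF power_m_cube, of y] m_pos by (cases "y = 0") auto

text \<open>Carries the cube roots of unity of the field to the complex ones. The last branch stands
  for \<open>w * w\<close>, the only remaining value of an \<open>m\<close>-th power.\<close>

definition root_char :: "'a \<Rightarrow> complex" where
  "root_char v = (if v = 0 then 0 else if v = 1 then 1 else if v = w then cis3 else cnj cis3)"

definition chi :: "'a \<Rightarrow> complex" where "chi y = root_char (y ^ m)"

lemma root_char_simps: "root_char 0 = 0" "root_char 1 = 1" "root_char w = cis3" "root_char (w * w) = cnj cis3"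
  using w_neq_0 w_neq_1 w_sq_neq by (auto simp: root_char_def)

lemma chi_0: "chi 0 = 0" and chi_1: "chi 1 = 1" and chi_z0: "chi z0 = cis3"
  by (simp_all add: chi_def root_char_simps zero_power_m flip: w_def)

lemma chi_mult: "chi (x * y) = chi x * chi y"
proof -
  have w4: "w * w * (w * w) = w" "w * w * w = 1" using w_cube by (simp_all add: mult.assoc)
  have c4: "cnj cis3 * cnj cis3 = cis3" using cis3_sq by (metis complex_cnj_cnj complex_cnj_mult)
  have "root_char (u * v) = root_char u * root_char v"
    if "u \<in> {0, 1, w, w * w}" "v \<in> {0, 1, w, w * w}" for u v
    using that
    by (elim insertE emptyE;
        simp add: root_char_simps w4 c4 w_cube cis3_sq cis3_cnj cis3_cnj[unfolded mult.commute[of cis3]])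
  then show ?thesis
    using power_m_cases[of x] power_m_cases[of y] by (simp add: chi_def power_mult_distrib)
qed

lemma chi_sq: "chi x * chi x = cnj (chi x)"
  using power_m_cases[of x] cis3_sq
  by (auto simp: chi_def root_char_simps zero_power_m simp flip: complex_cnj_mult)

lemma chi_cnj: "x \<noteq> 0 \<Longrightarrow> chi x * cnj (chi x) = 1"
  using power_m_cases[of x] cis3_cnj
  by (auto simp: chi_def root_char_simps zero_power_m cis3_cnj[unfolded mult.commute[of cis3]])

text \<open>Since \<open>- 1\<close> is its own cube, its \<open>m\<close>-th power equals the cube
  of that power, which is 1.\<close>

lemma minus_one_power_m: "(- 1) ^ m = (1::'a)"
  using power_m_cube[of "- 1"] power_mult[of "- 1::'a" 3 m] power_mult[of "- 1::'a" m 3]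
  by (simp add: mult.commute)

lemma chi_minus: "chi (- x) = chi x"
  by (simp add: chi_def power_minus[of x] minus_one_power_m)

text \<open>Scaling by \<open>z0\<close> permutes the field and multiplies the sum by
  \<open>cis3\<close>.\<close>

lemma sum_chi: "sum chi UNIV = 0"
proof -
  have "(\<Sum>y\<in>UNIV. chi (z0 * y)) = sum chi UNIV"
    by (rule sum.reindex_bij_witness[of _ "\<lambda>x. x / z0" "\<lambda>x. z0 * x"]) (use z0 in auto)
  then have "(cis3 - 1) * sum chi UNIV = 0"
    by (simp add: chi_mult chi_z0 left_diff_distrib flip: sum_distrib_left)
  then show ?thesis using cis3_neq_1 by simp
qed

lemma sum_cnj_chi: "(\<Sum>y\<in>UNIV. cnj (chi y)) = 0"
  using sum_chi by (metis cnj_sum complex_cnj_zero)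

definition jacobi :: complex where "jacobi = (\<Sum>y\<in>UNIV. chi y * chi (1 - y))"

abbreviation chib :: "'a \<Rightarrow> complex" where "chib \<equiv> (\<lambda>y. cnj (chi y))"
abbreviation delta :: "'a \<Rightarrow> complex" where "delta \<equiv> (\<lambda>y. if y = 0 then 1 else 0)"

text \<open>The substitution of \<open>z * y\<close> for \<open>y\<close> pulls \<open>z\<close> out
  of both multiplicative functions.\<close>

lemma conv_scaled_argument:
  fixes z :: 'a and u v :: "'a \<Rightarrow> complex"
  assumes "z \<noteq> 0" "\<And>x y. u (x * y) = u x * u y" "\<And>x y. v (x * y) = v x * v y"
  shows "conv u v z = u z * v z * (\<Sum>y\<in>UNIV. u y * v (1 - y))"
proof -
  have "conv u v z = (\<Sum>y\<in>UNIV. u (z * y) * v (z - z * y))"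
    unfolding conv_def
    by (rule sum.reindex_bij_witness[of _ "\<lambda>x. z * x" "\<lambda>x. x / z"]) (use assms(1) in auto)
  also have "\<dots> = (\<Sum>y\<in>UNIV. u (z * y) * v (z * (1 - y)))"
    by (simp add: right_diff_distrib)
  finally show ?thesis by (simp add: assms sum_distrib_left mult_ac)
qed

text \<open>At the origin the summands are \<open>chi y * chi (- y) = chib y\<close>, with sum zero;
  elsewhere scaling applies and \<open>chi z * chi z = chib z\<close>.\<close>

lemma conv_chi_chi: "conv chi chi = (\<lambda>z. jacobi * chib z)"
proof
  fix z
  show "conv chi chi z = jacobi * chib z"
  proof (cases "z = 0")
    case True
    have "conv chi chi 0 = 0" by (simp add: conv_def chi_minus chi_sq sum_cnj_chi)
    then show ?thesis using True by (simp add: chi_0)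
  next
    case False
    then show ?thesis
      using conv_scaled_argument[of z chi chi] by (simp add: chi_mult jacobi_def chi_sq mult.commute)
  qed
qed

lemma conv_chib_chib: "conv chib chib = (\<lambda>z. cnj jacobi * chi z)"
proof
  fix z
  have "conv chib chib z = cnj (conv chi chi z)" by (simp add: conv_def)
  then show "conv chib chib z = cnj jacobi * chi z" by (simp add: conv_chi_chi)
qed

text \<open>Off the origin the convolution is constant by scaling, and its values sum to zero.\<close>

lemma conv_chi_chib: "conv chi chib = (\<lambda>z. of_nat CARD('a) * delta z + (- 1))"
proof -
  define k where "k = (\<Sum>y\<in>UNIV. chi y * chib (1 - y))"
  have z: "conv chi chib z = k" if "z \<noteq> 0" for z
    using conv_scaled_argument[of z chi chib] chi_cnj[OF that] that by (simp add: chi_mult k_def)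
  have "conv chi chib 0 = (\<Sum>y\<in>(UNIV::'a set). 1 - delta y)"
    unfolding conv_def by (intro sum.cong) (auto simp: chi_minus chi_cnj chi_0)
  then have c0: "conv chi chib 0 = of_nat CARD('a) - 1" by (simp add: sum_subtractf)
  have "0 = sum (conv chi chib) UNIV" by (simp add: sum_conv sum_chi)
  also have "\<dots> = conv chi chib 0 + (\<Sum>z\<in>UNIV - {0}. conv chi chib z)"
    by (rule sum.remove) auto
  also have "(\<Sum>z\<in>UNIV - {0}. conv chi chib z) = (\<Sum>z\<in>UNIV - {0::'a}. k)"
    by (intro sum.cong) (auto simp: z)
  also have "\<dots> = of_nat (3 * m) * k" by (simp add: card_eq)
  finally have "of_nat (3 * m) * (k + 1) = 0" using c0 card_eq by (simp add: algebra_simps)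
  then have "k = - 1" using m_pos by (simp add: eq_neg_iff_add_eq_0)
  then show ?thesis using z c0 by (intro ext) auto
qed

text \<open>The triple convolution of \<open>chi\<close>, \<open>chi\<close>, \<open>chib\<close> at
  1, bracketed in two ways.\<close>

lemma jacobi_norm: "jacobi * cnj jacobi = of_nat CARD('a)"
proof -
  have "conv (conv chi chi) chib 1 = jacobi * cnj jacobi"
    unfolding conv_chi_chi conv_scale_left conv_chib_chib by (simp add: chi_1)
  moreover have "conv (conv chi chi) chib 1 = conv (\<lambda>z. of_nat CARD('a) * delta z + (- 1)) chi 1"
    by (simp only: conv_assoc conv_chi_chib conv_commute[of chi
        "\<lambda>z. of_nat CARD('a) * delta z + (- 1)"])
  moreover have "\<dots> = of_nat CARD('a)"
    by (simp only: conv_add_left conv_scale_left conv_delta_left conv_const_left sum_chi chi_1) simp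
  ultimately show ?thesis by simp
qed

section \<open>Convolution powers of the trace of the character\<close>

text \<open>Takes the value 2 at nonzero cubes, -1 at noncubes and 0 at zero.\<close>

definition gper :: "'a \<Rightarrow> complex" where "gper y = chi y + chib y"

abbreviation trace :: complex where "trace \<equiv> jacobi + cnj jacobi"

lemma conv_gper_2:
  "conv gper gper = (\<lambda>z. (jacobi * chib z + cnj jacobi * chi z)
      + (2 * of_nat CARD('a) * delta z + (- 2)))"
proof
  fix z
  have "conv gper gper z = (conv chi chi z + conv chi chib z) + (conv chib chi z + conv chib chib z)"
    unfolding gper_def[abs_def] by (simp only: conv_add_left conv_add_right)
  also have "conv chib chi = conv chi chib" by (rule conv_commute)
  finally show "conv gper gper z
      = (jacobi * chib z + cnj jacobi * chi z) + (2 * of_nat CARD('a) * delta z + (- 2))"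
    by (simp add: conv_chi_chi conv_chi_chib conv_chib_chib)
qed

lemma sum_gper: "sum gper UNIV = 0"
  by (simp add: gper_def sum.distrib sum_chi sum_cnj_chi)

text \<open>Convolving \<open>conv_gper_2\<close> with \<open>gper\<close>, the constant drops out,
  \<open>delta\<close> contributes \<open>2 q gper\<close>, and the Jacobi terms contribute another
  \<open>q gper\<close> through \<open>jacobi_norm\<close> besides the multiples of
  \<open>trace\<close>.\<close>

lemma conv_gper_3:
  "conv (conv gper gper) gper =
    (\<lambda>z. 3 * of_nat CARD('a) * gper z + (trace * of_nat CARD('a) * delta z + (- trace)))"
proof
  fix z
  have "conv (conv gper gper) gper z
      = (jacobi * conv chib gper z + cnj jacobi * conv chi gper z) + 2 * of_nat CARD('a) * gper z"
    unfolding conv_gper_2 conv_add_left conv_scale_left conv_delta_left conv_const_left sum_gper by simp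
  also have "conv chib gper z = conv chi chib z + conv chib chib z"
    unfolding gper_def[abs_def] conv_add_right by (simp add: conv_commute[of chib chi])
  also have "conv chi gper z = conv chi chi z + conv chi chib z"
    unfolding gper_def[abs_def] conv_add_right by simp
  also have "jacobi * (conv chi chib z + conv chib chib z) + cnj jacobi * (conv chi chi z + conv chi chib z)
      + 2 * of_nat CARD('a) * gper z
    = trace * (of_nat CARD('a) * delta z - 1) + (jacobi * cnj jacobi) * gper z + 2 * of_nat CARD('a) * gper z"
    unfolding conv_chi_chi conv_chi_chib conv_chib_chib gper_def by (simp add: algebra_simps)
  finally show "conv (conv gper gper) gper z =
      3 * of_nat CARD('a) * gper z + (trace * of_nat CARD('a) * delta z + (- trace))"
    unfolding jacobi_norm by (simp add: algebra_simps)
qed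

primrec gpow :: "nat \<Rightarrow> 'a \<Rightarrow> complex" where
  "gpow 0 = delta"
| "gpow (Suc n) = conv gper (gpow n)"

lemma gpow_1: "gpow (Suc 0) = gper"
  by (simp add: conv_commute[of gper] conv_delta_left fun_eq_iff)

lemma sum_gpow: "n \<ge> 1 \<Longrightarrow> sum (gpow n) UNIV = 0"
  by (cases n) (auto simp: sum_conv sum_gper)

text \<open>Convolve \<open>conv_gper_3\<close> with \<open>gpow n\<close>. The constant
  \<open>- trace\<close> meets the sum of \<open>gpow n\<close>, which is zero from
  \<open>n = 1\<close> on but 1 for \<open>n = 0\<close>.\<close>

lemma gpow_rec:
  assumes "n \<ge> 1"
  shows "gpow (n + 3) z = 3 * of_nat CARD('a) * gpow (n + 1) z + of_nat CARD('a) * trace * gpow n z"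
proof -
  have "gpow (n + 3) = conv (conv (conv gper gper) gper) (gpow n)"
    by (simp add: numeral_3_eq_3 conv_assoc)
  then show ?thesis
    unfolding conv_gper_3
    by (simp only: conv_add_left conv_scale_left conv_delta_left conv_const_left sum_gpow[OF assms]) simp
qed

lemma card_cube_roots: "of_nat (card {x. x ^ 3 = y}) = 1 + gper y"
proof (cases "y = 0")
  case True
  then show ?thesis by (simp add: gper_def chi_0)
next
  case y: False
  show ?thesis
  proof (cases "y ^ m = 1")
    case True
    then have "cubic y" using cubic_iff_power_eq_1[OF card_eq y] by simp
    then obtain t where t: "t \<noteq> 0" "y = t ^ 3" by (auto simp: cubic_def)
    have "{x. x ^ 3 = y} = {t, t * w, t * (w * w)}"
    proof (intro equalityI subsetI)
      fix x assume "x \<in> {x. x ^ 3 = y}"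
      then have "(x / t) ^ 3 = 1" using t by (simp add: power_divide)
      then have "x / t = 1 \<or> x / t = w \<or> x / t = w * w" by (rule cube_roots_of_unity)
      then show "x \<in> {t, t * w, t * (w * w)}" using t by (auto simp: field_simps)
    next
      have "w ^ 3 = 1" using w_cube by (simp add: power3_eq_cube mult.assoc)
      then show "x \<in> {x. x ^ 3 = y}" if "x \<in> {t, t * w, t * (w * w)}" for x
        using that t by (auto simp: power_mult_distrib)
    qed
    moreover have "card {t, t * w, t * (w * w)} = 3"
      using t w_neq_1 w_neq_0 w_sq_neq by auto
    ultimately show ?thesis using True by (simp add: gper_def chi_def root_char_simps)
  next
    case False
    then have "\<not> cubic y" using cubic_iff_power_eq_1[OF card_eq y] by simp
    then have "{x. x ^ 3 = y} = {}" using y by (auto simp: cubic_def)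
    moreover have "gper y = - 1"
      using False y power_m_cases[of y] cis3_add_cnj
      by (auto simp: gper_def chi_def root_char_simps add.commute)
    ultimately show ?thesis by simp
  qed
qed

text \<open>In the convolution of \<open>1 + gper\<close> with \<open>q ^ n + gpow (Suc n)\<close>
  the cross terms vanish, because both \<open>gper\<close> and \<open>gpow (Suc n)\<close> sum to
  zero.\<close>

lemma num_sol_eq_gpow:
  "of_nat (num_sol (Suc n) z) = of_nat CARD('a) ^ n + gpow (Suc n) z"
proof (induction n arbitrary: z)
  case 0
  have "num_sol 0 = (\<lambda>z::'a. if z = 0 then 1 else 0)"
    by (auto simp: num_sol_def fun_eq_iff cong: conj_cong)
  then have "of_nat (num_sol (Suc 0) z) = conv (\<lambda>y. of_nat (card {x. x ^ 3 = y})) delta z"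
    unfolding num_sol_Suc_conv by (simp add: if_distrib cong: if_cong)
  also have "\<dots> = 1 + gper z"
    by (simp add: conv_commute[of _ delta] conv_delta_left card_cube_roots)
  finally show ?case by (simp add: gpow_1 del: gpow.simps)
next
  case (Suc n)
  have "of_nat (num_sol (Suc (Suc n)) z)
      = conv (\<lambda>y. 1 + gper y) (\<lambda>y. of_nat CARD('a) ^ n + gpow (Suc n) y) z"
    unfolding num_sol_Suc_conv[of "Suc n"] card_cube_roots Suc.IH ..
  also have "\<dots> = (\<Sum>y\<in>(UNIV::'a set). of_nat CARD('a) ^ n) + sum (gpow (Suc n)) UNIV
      + (conv (\<lambda>y. of_nat CARD('a) ^ n) gper z + conv gper (gpow (Suc n)) z)"
    unfolding conv_add_left conv_add_right conv_const_left
    by (simp add: conv_commute[of gper "\<lambda>y. of_nat CARD('a) ^ n"] conv_const_left del: gpow.simps)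
  finally show ?case by (simp add: conv_const_left sum_gper sum_conv)
qed

section \<open>Integer coordinates of the Jacobi sum and their residues\<close>

text \<open>Suited to the Jacobi sum, whose summand is
  \<open>root_char ((y * (1 - y)) ^ m)\<close>.\<close>

definition class_count :: "'a \<Rightarrow> nat" where
  "class_count v = card {y. (y * (1 - y)) ^ m = v}"

text \<open>The values of \<open>h\<close> lie in an arbitrary ring, so that the same class counts
  express both the complex Jacobi sum and power sums in the field.\<close>

lemma sum_over_classes:
  fixes h :: "'a \<Rightarrow> 'b::comm_ring_1"
  assumes "h 0 = 0"
  shows "(\<Sum>y\<in>UNIV. h ((y * (1 - y)) ^ m)) =
    of_nat (class_count 1) * h 1 + of_nat (class_count w) * h w + of_nat (class_count (w * w)) * h (w * w)"
proof -
  have one: "(\<Sum>y\<in>UNIV. if (y * (1 - y)) ^ m = v then h v else 0) = of_nat (class_count v) * h v" for v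
    by (simp add: sum.If_cases class_count_def)
  have "(\<Sum>y\<in>UNIV. h ((y * (1 - y)) ^ m)) =
    (\<Sum>y\<in>UNIV. (if (y * (1 - y)) ^ m = 1 then h 1 else 0) + (if (y * (1 - y)) ^ m = w then h w else 0)
      + (if (y * (1 - y)) ^ m = w * w then h (w * w) else 0))"
  proof (rule sum.cong)
    fix y :: 'a
    have w: "w \<noteq> 1" "1 \<noteq> w" "w * w \<noteq> 1" "1 \<noteq> w * w" "w * w \<noteq> w"
        "w \<noteq> w * w" "w \<noteq> 0" "w * w \<noteq> 0" "0 \<noteq> w" "0 \<noteq> w * w"
      using w_neq_1 w_sq_neq w_neq_0 by metis+
    define v where "v = (y * (1 - y)) ^ m"
    have "v = 0 \<or> v = 1 \<or> v = w \<or> v = w * w" unfolding v_def by (rule power_m_cases)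
    then show "h ((y * (1 - y)) ^ m) = (if (y * (1 - y)) ^ m = 1 then h 1 else 0)
      + (if (y * (1 - y)) ^ m = w then h w else 0) + (if (y * (1 - y)) ^ m = w * w then h (w * w) else 0)"
      unfolding v_def[symmetric]
          using w assms by (elim disjE) (simp_all only: if_True if_False refl zero_neq_one add_0_left add_0_right)
  qed simp
  then show ?thesis by (simp only: sum.distrib one)
qed

text \<open>With \<open>jb\<close>, the coordinates of the Jacobi sum in the basis \<open>1\<close>,
  \<open>cis3\<close>; the third class is eliminated by
  \<open>cnj cis3 = - 1 - cis3\<close>.\<close>

definition ja :: int where "ja = int (class_count 1) - int (class_count (w * w))"
definition jb :: int where "jb = int (class_count w) - int (class_count (w * w))"

lemma jacobi_eq: "jacobi = of_int ja + of_int jb * cis3"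
proof -
  have "jacobi = (\<Sum>y\<in>UNIV. root_char ((y * (1 - y)) ^ m))"
    unfolding jacobi_def chi_def[symmetric] by (simp add: chi_mult)
  also have "\<dots> = of_nat (class_count 1) + of_nat (class_count w) * cis3
      + of_nat (class_count (w * w)) * cnj cis3"
    by (subst sum_over_classes) (simp_all add: root_char_simps)
  finally show ?thesis by (simp add: cnj_cis3 ja_def jb_def algebra_simps)
qed

text \<open>The field analogue of \<open>jacobi_eq\<close>, with \<open>w\<close> for
  \<open>cis3\<close>. The expanded sum involves only exponents from \<open>m\<close> to
  \<open>2 * m\<close>, strictly between 0 and \<open>q - 1\<close>, so it vanishes.\<close>

lemma field_relation_1: "of_int ja + of_int jb * w = 0"
proof -
  have "\<not> (CARD('a) - 1) dvd (m + j)" if "j \<le> m" for j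
  proof
    assume "(CARD('a) - 1) dvd (m + j)"
    then have "3 * m \<le> m + j" using card_eq m_pos by (intro dvd_imp_le) auto
    then show False using that m_pos by simp
  qed
  then have "(\<Sum>y\<in>UNIV. (y * (1 - y)) ^ m) = (0::'a)"
    unfolding sum_power_times_one_minus by (intro sum.neutral) (auto simp: sum_power_eq_0)
  then have "of_nat (class_count 1) + of_nat (class_count w) * w + of_nat (class_count (w * w)) * (w * w) = 0"
    using sum_over_classes[of "\<lambda>x. x"] by simp
  then show ?thesis unfolding w_sq ja_def jb_def by (simp add: algebra_simps)
qed

text \<open>Squaring exchanges \<open>w\<close> and \<open>w * w\<close>. Of the exponents
  \<open>2 * m + j\<close> with \<open>j \<le> 2 * m\<close>, only \<open>3 * m = q - 1\<close> has
  a nonzero power sum, namely -1.\<close>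

lemma field_relation_2: "of_int ja + of_int jb * (w * w) = of_nat (2 * m choose m) * (- 1) ^ m * (- 1 :: 'a)"
proof -
  have nd: "\<not> (CARD('a) - 1) dvd (2 * m + j)" if "j \<le> 2 * m" "j \<noteq> m" for j
  proof
    assume "(CARD('a) - 1) dvd (2 * m + j)"
    then obtain k where k: "2 * m + j = 3 * m * k" using card_eq by (auto elim: dvdE)
    have "k = 1"
    proof (cases k)
      case 0 then show ?thesis using k m_pos by simp
    next
      case (Suc l)
      have "l = 0"
      proof (rule ccontr)
        assume "l \<noteq> 0"
        then have "3 * m * 2 \<le> 3 * m * k" using Suc by (intro mult_left_mono) auto
        then show False using k that(1) m_pos by linarith
      qed
      then show ?thesis using Suc by simp
    qed
    then show False using k that(2) by simp
  qed
  have "(\<Sum>y\<in>UNIV. (y * (1 - y)) ^ (2 * m)) =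
      (\<Sum>j\<le>2 * m. if j = m then of_nat (2 * m choose m) * (- 1) ^ m * (- 1 :: 'a) else 0)"
    unfolding sum_power_times_one_minus
  proof (rule sum.cong)
    fix j assume j: "j \<in> {..2 * m}"
    have "2 * m + m = CARD('a) - 1" using card_eq by simp
    then have "(\<Sum>y\<in>UNIV. y ^ (2 * m + j)) = (if j = m then - 1 else 0 :: 'a)"
      using sum_power_card_minus_1[where 'a='a] sum_power_eq_0[OF nd[of j]] j by auto
    then show "of_nat (2 * m choose j) * (- 1) ^ j * (\<Sum>y\<in>UNIV. y ^ (2 * m + j)) =
        (if j = m then of_nat (2 * m choose m) * (- 1) ^ m * (- 1 :: 'a) else 0)" by simp
  qed simp
  also have "\<dots> = of_nat (2 * m choose m) * (- 1) ^ m * (- 1)"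
    by (subst sum.delta) auto
  finally have *: "(\<Sum>y\<in>UNIV. ((y * (1 - y)) ^ m) ^ 2) = of_nat (2 * m choose m) * (- 1) ^ m * (- 1 :: 'a)"
    by (simp add: mult.commute flip: power_mult)
  have "(\<Sum>y\<in>UNIV. ((y * (1 - y)) ^ m) ^ 2) =
    of_nat (class_count 1) + of_nat (class_count w) * (w * w) + of_nat (class_count (w * w)) * w"
    using sum_over_classes[of "\<lambda>x. x ^ 2"] w_cube by (simp add: power2_eq_square mult.assoc)
  also have "of_nat (class_count (w * w)) * w = of_nat (class_count (w * w)) * (- 1 - w * w)"
    by (simp add: w_sq)
  also have "of_nat (class_count 1) + of_nat (class_count w) * (w * w)
      + of_nat (class_count (w * w)) * (- 1 - w * w)
      = of_int ja + of_int jb * (w * w)"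
    unfolding ja_def jb_def by (simp add: algebra_simps)
  finally show ?thesis using * by simp
qed

text \<open>
  The map \<open>y \<mapsto> 1 / (1 - y)\<close> has order three and multiplies \<open>y (1 - y)\<close> by a cube, so it
  acts on each class. Its fixed points \<open>- w\<close> and \<open>- w\<^sup>2\<close> lie in the class of \<open>1\<close>.
\<close>

lemma dvd3_card_class_without_fixpoints:
  fixes v :: 'a
  shows "3 dvd card {y. y \<noteq> 0 \<and> y \<noteq> 1 \<and> y * (1 - y) \<noteq> 1 \<and> (y * (1 - y)) ^ m = v}"
proof (rule dvd3_card_of_fixpoint_free)
  fix y assume y: "y \<in> {y. y \<noteq> 0 \<and> y \<noteq> 1 \<and> y * (1 - y) \<noteq> 1 \<and> (y * (1 - y)) ^ m = v}"
  let ?s = "\<lambda>y. 1 / (1 - y)"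
  have "y \<noteq> 1" using y by blast
  then have y': "y \<noteq> 0" "1 - y \<noteq> 0" "y * (1 - y) \<noteq> 1" "(y * (1 - y)) ^ m = v"
    using y right_minus_eq[of 1 y] by blast+
  have e: "?s y * (1 - ?s y) = - (y * (1 - y)) / (1 - y) ^ 3"
  proof -
    have "1 / t * (1 - 1 / t) = - ((1 - t) * t) / t ^ 3" if "t \<noteq> 0" for t :: 'a
      using that by (simp add: field_simps power3_eq_cube)
    from this[of "1 - y"] y' show ?thesis by simp
  qed
  have "1 - ?s y = - y / (1 - y)" using y'(2) by (simp add: divide_simps)
  then have "1 - ?s (?s y) = 1 / y" using y'(1,2) by (simp add: divide_simps)
  then show "?s (?s (?s y)) = y" by simp
  show "?s y \<noteq> y" using y'(3) nonzero_divide_eq_eq[OF y'(2), of 1 y] by metis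
  \<comment> \<open>With \<open>t = 1 - y\<close> the equation for the image becomes
    \<open>t - 1 = t * t\<close>, which says \<open>y * (1 - y) = 1\<close>.\<close>
  have "?s y * (1 - ?s y) \<noteq> 1"
  proof
    assume "?s y * (1 - ?s y) = 1"
    moreover have "t - 1 = t * t" if "t \<noteq> 0" "1 / t * (1 - 1 / t) = 1" for t :: 'a
      using that by (simp add: field_simps)
    ultimately have "(1 - y) - 1 = (1 - y) * (1 - y)" using y'(2) by blast
    moreover have "y * (1 - y) = (1 - y) - (1 - y) * (1 - y)" by (simp add: algebra_simps)
    ultimately show False using y'(3) by simp
  qed
  moreover have "(?s y * (1 - ?s y)) ^ m = v"
  proof -
    have "((1 - y) ^ 3) ^ m = 1" using power_m_cube[OF y'(2)] by (simp add: mult.commute flip: power_mult)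
    then show ?thesis
      unfolding e power_divide power_minus[of "y * (1 - y)"] y'(4) by (simp add: minus_one_power_m)
  qed
  ultimately show "?s y \<in> {y. y \<noteq> 0 \<and> y \<noteq> 1 \<and> y * (1 - y) \<noteq> 1 \<and> (y * (1 - y)) ^ m = v}"
    using y' by simp
qed simp

text \<open>For \<open>w\<close> and \<open>w * w\<close> the excluded points lie outside the class.
  The class of 1 contains in addition the two roots \<open>- w\<close> and \<open>- (w * w)\<close>
  of \<open>y * y - y + 1\<close>. The final bound makes the natural subtraction genuine.\<close>

lemma class_count_mod_3:
  "3 dvd class_count w" "3 dvd class_count (w * w)" "3 dvd (class_count 1 - 2)" "class_count 1 \<ge> 2"
proof -
  have *: "class_count v = card {y. y \<noteq> 0 \<and> y \<noteq> 1 \<and> y * (1 - y) \<noteq> 1 \<and> (y * (1 - y)) ^ m = v}"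
    if "v \<noteq> 0" "v \<noteq> 1" for v
    unfolding class_count_def using that m_pos
    by (intro arg_cong[of _ _ card] Collect_cong) (auto simp: zero_power_m)
  show "3 dvd class_count w" "3 dvd class_count (w * w)"
    using *[of w] *[of "w * w"] dvd3_card_class_without_fixpoints w_neq_0 w_neq_1 w_sq_neq by simp_all
  let ?S = "{y::'a. y \<noteq> 0 \<and> y \<noteq> 1 \<and> y * (1 - y) \<noteq> 1 \<and> (y * (1 - y)) ^ m = 1}"
  have fp: "y * (1 - y) = 1 \<longleftrightarrow> y = - w \<or> y = - (w * w)" for y
  proof -
    have "(y + w) * (y + w * w) = y * y - y + 1"
      using w_cube by (simp add: algebra_simps w_sq)
    moreover have "y * (1 - y) = 1 \<longleftrightarrow> y * y - y + 1 = 0"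
      by (auto simp: algebra_simps eq_diff_eq diff_eq_eq)
    ultimately have "y * (1 - y) = 1 \<longleftrightarrow> (y + w) * (y + w * w) = 0" by simp
    then show ?thesis by (simp add: eq_neg_iff_add_eq_0)
  qed
  have split: "{y. (y * (1 - y)) ^ m = 1} = ?S \<union> {- w, - (w * w)}"
  proof (rule Set.set_eqI)
    fix y
    show "y \<in> {y. (y * (1 - y)) ^ m = 1} \<longleftrightarrow> y \<in> ?S \<union> {- w, - (w * w)}"
    proof (cases "y * (1 - y) = 1")
      case True
      then show ?thesis using fp[of y] by (simp only: mem_Collect_eq power_one Un_iff insert_iff) simp
    next
      case False
      then have "(y * (1 - y)) ^ m = 1 \<longleftrightarrow> y \<in> ?S" by (auto simp: zero_power_m)
      then show ?thesis using fp[of y] False by blast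
    qed
  qed
  have disj: "?S \<inter> {- w, - (w * w)} = {}" using fp by auto
  have "class_count 1 = card ?S + card {- w, - (w * w)}"
    unfolding class_count_def split by (rule card_Un_disjoint[OF finite finite disj])
  moreover have "card {- w, - (w * w)} = 2" using w_sq_neq by auto
  ultimately have c1: "class_count 1 = card ?S + 2" by simp
  then show "class_count 1 \<ge> 2" by simp
  show "3 dvd (class_count 1 - 2)" using c1 dvd3_card_class_without_fixpoints[of 1] by simp
qed

definition jc :: int where "jc = 2 * ja - jb"
definition jd :: int where "jd = jb div 3"

lemma jb_eq: "jb = 3 * jd"
proof -
  have "3 dvd int (class_count w)" "3 dvd int (class_count (w * w))"
    using class_count_mod_3(1,2) by (metis of_nat_dvd_iff of_nat_numeral)+
  then have "3 dvd jb" unfolding jb_def by (rule dvd_diff)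
  then show ?thesis by (simp add: jd_def)
qed

lemma jc_mod_3: "[jc = 1] (mod 3)"
proof -
  obtain k1 k2 k3 where "class_count w = 3 * k1" "class_count (w * w) = 3 * k2" "class_count 1 - 2 = 3 * k3"
    using class_count_mod_3(1-3) by (metis dvdE)
  moreover from this have "class_count 1 = 3 * k3 + 2" using class_count_mod_3(4) by linarith
  ultimately have "jc - 1 = 3 * (2 * int k3 + 1 - int k2 - int k1)"
    unfolding jc_def ja_def jb_def by simp
  then show ?thesis by (metis cong_iff_dvd_diff dvd_triv_left)
qed

lemma trace_eq: "trace = of_int jc"
  unfolding jacobi_eq jc_def by (simp add: cnj_cis3 algebra_simps)

text \<open>The norm is \<open>a^2 - a b + b^2\<close>, and four times it is
  \<open>(2 a - b)^2 + 3 b^2\<close> with \<open>b = 3 d\<close>.\<close>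

lemma four_q: "4 * int CARD('a) = jc ^ 2 + 27 * jd ^ 2"
proof -
  have "of_int (int CARD('a)) = jacobi * cnj jacobi" by (simp add: jacobi_norm)
  also have "\<dots> = of_int ja * of_int ja + of_int ja * of_int jb * (cis3 + cnj cis3)
      + of_int jb * of_int jb * (cis3 * cnj cis3)"
    unfolding jacobi_eq by (simp add: algebra_simps)
  also have "\<dots> = of_int (ja * ja - ja * jb + jb * jb)"
    unfolding cis3_add_cnj cis3_cnj by simp
  finally have "int CARD('a) = ja * ja - ja * jb + jb * jb" by (simp only: of_int_eq_iff)
  moreover have "27 * jd ^ 2 = 3 * jb ^ 2" unfolding jb_eq by (simp add: power2_eq_square)
  ultimately show ?thesis unfolding jc_def by (simp add: power2_eq_square algebra_simps)
qed

lemma two_w_plus_1: "(2 * w + 1) * (2 * w + 1) = - 3"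
proof -
  have "(2 * w + 1) * (2 * w + 1) = 4 * (w * w) + 4 * w + 1" by (simp add: algebra_simps)
  then show ?thesis by (simp add: w_sq)
qed

lemma jc_field: "of_int jc = - of_int jb * (2 * w + 1)"
proof -
  have "of_int ja = - (of_int jb * w)" using field_relation_1 by (simp add: eq_neg_iff_add_eq_0)
  then show ?thesis unfolding jc_def by (simp add: algebra_simps)
qed

text \<open>Multiply \<open>jc_field\<close> by \<open>2 * w + 1\<close>, a square root of
  \<open>-3\<close>: this gives \<open>3 * jb\<close>, which is \<open>9 * jd\<close>.\<close>

lemma jd_cong: "of_int (9 * jd) = of_int jc * (2 * w + 1)"
proof -
  have "of_int jc * (2 * w + 1) = - of_int jb * ((2 * w + 1) * (2 * w + 1))"
    unfolding jc_field by (simp only: mult.assoc)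
  also have "\<dots> = of_int (3 * jb)" unfolding two_w_plus_1 by simp
  finally show ?thesis by (simp add: jb_eq)
qed

text \<open>If \<open>jc\<close> vanished in the field, so would \<open>jb\<close> and then
  \<open>ja\<close>, against \<open>field_relation_2\<close>.\<close>

lemma jc_neq_0:
  assumes "of_nat (2 * m choose m) \<noteq> (0::'a)"
  shows "of_int jc \<noteq> (0::'a)"
proof
  assume "of_int jc = (0::'a)"
  then have "of_int jb * (2 * w + 1) = 0" using jc_field by simp
  moreover have "2 * w + 1 \<noteq> 0" using two_w_plus_1 three_neq_0 by auto
  ultimately have b: "of_int jb = (0::'a)" by simp
  then have "of_int ja = (0::'a)" using field_relation_1 by simp
  then have "of_nat (2 * m choose m) * (- 1) ^ m * (- 1 :: 'a) = 0" using field_relation_2 b by simp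
  then show False using assms by simp
qed

text \<open>Here \<open>g1\<close> and \<open>g2\<close> are the first two convolution powers of
  \<open>gper\<close> at \<open>z\<close>. By \<open>conv_gper_3\<close> the third is
  \<open>3 q g1 - jc\<close>, so the cubic coefficient of the numerator is
  \<open>- jc\<close>.\<close>

lemma gf_formula:
  assumes z: "z \<noteq> 0" and g: "of_int g1 = gper z" "of_int g2 = jacobi * chib z + cnj jacobi * chi z - 2"
  shows "num_sol_gf z = fps_X / (1 - of_nat CARD('a) * fps_X) +
    (fps_const (of_int g1) * fps_X + fps_const (of_int g2) * fps_X ^ 2 - of_int jc * fps_X ^ 3) /
    (1 - 3 * of_nat CARD('a) * fps_X ^ 2 - of_nat CARD('a) * of_int jc * fps_X ^ 3)"
proof -
  define b where "b n = int (num_sol n z) - int CARD('a) ^ (n - 1)" for n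
  have b: "of_int (b n) = gpow n z" if "n \<ge> 1" for n
    using that num_sol_eq_gpow[of "n - 1" z] by (cases n) (simp_all add: b_def del: gpow.simps)
  \<comment> \<open>The recurrence holds over the complex numbers; all its terms are integers, so it
    descends to the integers and then to the rationals.\<close>
  have rec: "b (n + 3) = 3 * int CARD('a) * b (n + 1) + int CARD('a) * jc * b n" if "n \<ge> 1" for n
  proof -
    have "of_int (b (n + 3)) = (of_int (3 * int CARD('a) * b (n + 1) + int CARD('a) * jc * b n) :: complex)"
      using gpow_rec[OF that, of z] that by (simp add: b trace_eq del: gpow.simps)
    then show ?thesis by (simp only: of_int_eq_iff)
  qed
  have "of_int (b 1) = (of_int g1 :: complex)" using b[of 1] g gpow_1 by (simp del: gpow.simps)
  then have b1: "b 1 = g1" by (simp only: of_int_eq_iff)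
  have "gpow 2 = conv gper gper" using gpow_1 by (simp add: numeral_2_eq_2)
  then have "of_int (b 2) = (of_int g2 :: complex)" using b[of 2] g z by (simp add: conv_gper_2)
  then have b2: "b 2 = g2" by (simp only: of_int_eq_iff)
  have "gpow 3 = conv (conv gper gper) gper" using gpow_1 by (simp add: numeral_3_eq_3 conv_assoc)
  then have "of_int (b 3) = 3 * of_nat CARD('a) * gper z - trace" using b[of 3] z by (simp add: conv_gper_3)
  then have "of_int (b 3) = (of_int (3 * int CARD('a) * g1 - jc) :: complex)" using g by (simp add: trace_eq)
  then have b3: "b 3 = 3 * int CARD('a) * g1 - jc" by (simp only: of_int_eq_iff)
  have "num_sol_gf z = Abs_fps (\<lambda>n. if n = 0 then 0 else of_nat CARD('a) ^ (n - 1) + of_int (b n))"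
    unfolding num_sol_gf_def by (intro fps_ext) (simp add: b_def)
  also have "\<dots> = fps_X / (1 - fps_const (of_nat CARD('a)) * fps_X) +
     (fps_const (of_int (b 1)) * fps_X + fps_const (of_int (b 2)) * fps_X ^ 2
       + fps_const (of_int (b 3) - 3 * of_nat CARD('a) * of_int (b 1)) * fps_X ^ 3) /
     (1 - 3 * fps_const (of_nat CARD('a)) * fps_X ^ 2
         - fps_const (of_nat CARD('a)) * fps_const (of_int jc) * fps_X ^ 3)"
    by (rule rational_gf) (simp add: rec)
  also have "of_int (b 3) - 3 * of_nat CARD('a) * of_int (b 1) = (- of_int jc :: rat)"
    unfolding b3 b1 by simp
  finally show ?thesis unfolding b1 b2 by (simp add: fps_of_nat fps_of_int flip: fps_const_neg)
qed

end

section \<open>Determination of \<open>c\<close> and \<open>d\<close>, and the two cases of the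
  theorem\<close>

lemma CHAR_eq_prime:
  assumes "prime p" "CARD('a::{field,finite}) = p ^ k"
  shows "CHAR('a) = p"
proof -
  have "CHAR('a) > 0" by (rule finite_imp_CHAR_pos) simp
  then have "prime CHAR('a)" by (rule prime_CHAR_semidom)
  moreover have "CHAR('a) dvd p ^ k" using CHAR_dvd_CARD[where 'a='a] assms by simp
  ultimately show ?thesis using assms(1) by (meson prime_dvd_power primes_dvd_imp_eq)
qed

lemma mod_3_cases_of_power_cong_1:
  fixes p :: nat
  assumes "[p ^ k = 1] (mod 3)" "k \<ge> 1"
  shows "[p = 1] (mod 3) \<or> [p = 2] (mod 3)"
proof -
  have "\<not> 3 dvd p"
  proof
    assume "3 dvd p"
    then have "3 dvd p ^ k" using assms(2) by (simp add: dvd_power_le[of 3 p 1 k, simplified])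
    then show False using assms(1) by (simp add: cong_def dvd_eq_mod_eq_0)
  qed
  then show ?thesis unfolding cong_def by presburger
qed

lemma cd_rep_unique:
  assumes "prime p" "k \<ge> 1" "q = p ^ k" "[q = 1] (mod 3)" "cd_rep p q c d" "cd_rep p q c' d'"
  shows "c = c' \<and> d ^ 2 = d' ^ 2"
proof (cases "[p = 1] (mod 3)")
  case True
  then show ?thesis using cd_rep_unique_split assms by blast
next
  case False
  then have "[p = 2] (mod 3)" using mod_3_cases_of_power_cong_1 assms by blast
  then have "d = 0" "d' = 0" using cd_rep_inert assms by blast+
  then show ?thesis using assms(5,6) eq_if_square_eq_cong_1_mod_3[of c c'] by (simp add: cd_rep_def)
qed

text \<open>For coprimality, the binomial coefficient is prime to \<open>p\<close>, so
  \<open>jc\<close> is nonzero in a field of characteristic \<open>p\<close>.\<close>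

lemma (in cubic_character) cd_rep_jacobi:
  assumes "prime p" "CARD('a) = p ^ k"
  shows "cd_rep p CARD('a) jc jd"
  unfolding cd_rep_def
proof (intro conjI impI)
  assume p: "[p = 1] (mod 3)"
  have ch: "CHAR('a) = p" using CHAR_eq_prime assms by blast
  have "\<not> p dvd (2 * m choose m)"
    using prime_not_dvd_third_binomial[of p m k] assms p card_eq by simp
  then have "of_nat (2 * m choose m) \<noteq> (0::'a)" by (simp add: of_nat_eq_0_iff_char_dvd ch)
  then have "\<not> int p dvd jc" using jc_neq_0 by (simp add: of_int_eq_0_iff_char_dvd ch)
  then show "coprime jc (int p)"
    using assms(1) by (simp add: prime_imp_coprime coprime_commute)
qed (use four_q jc_mod_3 in auto)

text \<open>Only the sign of \<open>d\<close> is left open. If both signs satisfied the congruence,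
  \<open>2 * jc * (2 * w + 1)\<close> would vanish in the field and \<open>p\<close> would divide 2,
  contrary to \<open>p\<close> being 1 modulo 3. For \<open>p\<close> equal to 2 modulo 3,
  \<open>d\<close> is zero.\<close>

lemma (in cubic_character) d_cong_unique:
  assumes p: "prime p" "k \<ge> 1" "CARD('a) = p ^ k" and r: "cd_rep p CARD('a) c d" "d_cong z0 c d"
  shows "c = jc \<and> d = jd"
proof -
  have q1: "[CARD('a) = 1] (mod 3)" unfolding card_eq by (simp add: cong_def)
  have cd: "c = jc" "d ^ 2 = jd ^ 2"
    using cd_rep_unique[OF p q1 r(1) cd_rep_jacobi[OF p(1,3)]] by blast+
  have "d = jd"
  proof (rule ccontr)
    assume ne: "d \<noteq> jd"
    then have d: "jd = - d" using cd(2) by (auto simp: power2_eq_iff)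
    have p1: "[p = 1] (mod 3)"
    proof (rule ccontr)
      assume "\<not> ?thesis"
      then have "[p = 2] (mod 3)" using mod_3_cases_of_power_cong_1[of p k] p q1 by simp
      then have "d = 0" using cd_rep_inert[OF p(1) _ p(3) q1 r(1)] by simp
      then show False using ne d by simp
    qed
    have ch: "CHAR('a) = p" using CHAR_eq_prime p by blast
    have "(CARD('a) - 1) div 3 = m" using card_eq by simp
    then have "of_int (9 * d) = of_int jc * (2 * w + 1)"
      using r(2) cd(1) by (simp add: d_cong_def w_def)
    then have "of_int jc * (2 * w + 1) + of_int jc * (2 * w + 1) = 0" using jd_cong d by simp
    then have "of_int (2 * jc) * (2 * w + 1) = 0" by (simp add: algebra_simps)
    moreover have "2 * w + 1 \<noteq> 0" using two_w_plus_1 three_neq_0 by auto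
    ultimately have "of_int (2 * jc) = (0::'a)" by simp
    then have "int p dvd 2 * jc" unfolding of_int_eq_0_iff_char_dvd ch .
    moreover have "coprime (int p) jc"
      using cd_rep_jacobi[OF p(1,3)] p1 by (simp add: cd_rep_def coprime_commute)
    ultimately have "int p dvd 2" by (simp add: coprime_dvd_mult_left_iff)
    then have "p \<le> 2" using zdvd_imp_le[of "int p" 2] by simp
    then have "p = 2" using prime_ge_2_nat[OF p(1)] by simp
    then show False using p1 by (simp add: cong_def)
  qed
  then show ?thesis using cd by simp
qed

lemma exists_cubic_character:
  assumes "CARD('a::{field,finite}) = 3 * m + 1"
  shows "\<exists>z::'a. cubic_character z m"
proof -
  have m: "m > 0" using assms card_field_ge_2[where 'a='a] by simp
  have "\<exists>z::'a. z \<noteq> 0 \<and> z ^ m \<noteq> 1"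
  proof (rule ccontr)
    assume "\<not> ?thesis"
    then have "UNIV - {0} \<subseteq> {y::'a. y ^ m = 1}" by auto
    then have "card (UNIV - {0::'a}) \<le> card {y::'a. y ^ m = 1}" by (intro card_mono) auto
    also have "\<dots> \<le> m" using m card_nth_roots_le by blast
    finally show False using assms m by simp
  qed
  then show ?thesis using assms by (auto simp: cubic_character_def)
qed

theorem theorem1p4:
  fixes z :: "'a::{field,finite}" and p k q :: nat
  assumes "prime p" and "k \<ge> 1" and "q = p ^ k" and "CARD('a) = q"
    and "[q = 1] (mod 3)" and "z \<noteq> 0"
  shows "(cubic z \<longrightarrow>
      (\<exists>!c. \<exists>d. cd_rep p q c d) \<and>
      (\<forall>c d. cd_rep p q c d \<longrightarrow>
        num_sol_gf z =
          fps_X / (1 - of_nat q * fps_X) +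
          (2 * fps_X + of_int (c - 2) * fps_X ^ 2 - of_int c * fps_X ^ 3) /
          (1 - 3 * of_nat q * fps_X ^ 2 - of_nat q * of_int c * fps_X ^ 3))) \<and>
    (\<not> cubic z \<longrightarrow>
      (\<exists>!(c, d). cd_rep p q c d \<and> d_cong z c d) \<and>
      (\<forall>c d. cd_rep p q c d \<and> d_cong z c d \<longrightarrow>
        num_sol_gf z =
          fps_X / (1 - of_nat q * fps_X) -
          (fps_X + fps_const (1 / 2 * of_int (4 + c - 9 * d)) * fps_X ^ 2 + of_int c * fps_X ^ 3) /
          (1 - 3 * of_nat q * fps_X ^ 2 - of_nat q * of_int c * fps_X ^ 3)))"
proof (intro conjI impI)
  define m where "m = (q - 1) div 3"
  have card: "CARD('a) = p ^ k" using assms by simp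
  have "q mod 3 = 1" using assms(5) by (simp add: cong_def)
  then have "q = 3 * m + 1" unfolding m_def by presburger
  then have qm: "CARD('a) = 3 * m + 1" using assms(4) by simp
  {
    assume cubic: "cubic z"
    \<comment> \<open>Any noncube may define the character here: \<open>chi z = 1\<close>, and the
      formula involves only the trace \<open>jc\<close>.\<close>
    obtain z0 :: 'a where "cubic_character z0 m" using exists_cubic_character qm by blast
    then interpret cubic_character z0 m .
    have rep: "cd_rep p q jc jd" using cd_rep_jacobi[OF assms(1) card] assms(4) by simp
    have uniq: "c = jc" if "cd_rep p q c d" for c d
      using cd_rep_unique[OF assms(1,2,3,5) that rep] by simp
    show "\<exists>!c. \<exists>d. cd_rep p q c d"
      using rep uniq by blast
    have "z ^ m = 1" using cubic cubic_iff_power_eq_1[OF qm assms(6)] by simp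
    then have chi: "chi z = 1" by (simp add: chi_def root_char_simps)
    have "num_sol_gf z = fps_X / (1 - of_nat q * fps_X) +
      (fps_const (of_int 2) * fps_X + fps_const (of_int (jc - 2)) * fps_X ^ 2 - of_int jc * fps_X ^ 3) /
      (1 - 3 * of_nat q * fps_X ^ 2 - of_nat q * of_int jc * fps_X ^ 3)"
      unfolding assms(4)[symmetric]
      by (rule gf_formula) (use assms(6) trace_eq in \<open>simp_all add: gper_def chi\<close>)
    moreover have "fps_const (of_int (jc - 2)) = (of_int (jc - 2) :: rat fps)" by (rule fps_of_int)
    moreover have "fps_const (of_int 2) = (2 :: rat fps)" by (simp add: numeral_fps_const)
    ultimately have gf: "num_sol_gf z = fps_X / (1 - of_nat q * fps_X) +
      (2 * fps_X + of_int (jc - 2) * fps_X ^ 2 - of_int jc * fps_X ^ 3) /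
      (1 - 3 * of_nat q * fps_X ^ 2 - of_nat q * of_int jc * fps_X ^ 3)" by (simp only:)
    show "\<forall>c d. cd_rep p q c d \<longrightarrow>
        num_sol_gf z =
          fps_X / (1 - of_nat q * fps_X) +
          (2 * fps_X + of_int (c - 2) * fps_X ^ 2 - of_int c * fps_X ^ 3) /
          (1 - 3 * of_nat q * fps_X ^ 2 - of_nat q * of_int c * fps_X ^ 3)"
    proof (intro allI impI)
      fix c d assume "cd_rep p q c d"
      then show "num_sol_gf z =
          fps_X / (1 - of_nat q * fps_X) +
          (2 * fps_X + of_int (c - 2) * fps_X ^ 2 - of_int c * fps_X ^ 3) /
          (1 - 3 * of_nat q * fps_X ^ 2 - of_nat q * of_int c * fps_X ^ 3)"
        using uniq gf by blast
    qed
  next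
    assume noncubic: "\<not> cubic z"
    then have zm: "z ^ m \<noteq> 1" using cubic_iff_power_eq_1[OF qm assms(6)] by simp
    \<comment> \<open>The character is normalised at \<open>z\<close> itself, so
      \<open>chi z = cis3\<close> and \<open>w\<close> is the power of \<open>z\<close> in
      \<open>d_cong\<close>.\<close>
    then interpret cubic_character z m using qm assms(6) by unfold_locales
    have rep: "cd_rep p q jc jd" using cd_rep_jacobi[OF assms(1) card] assms(4) by simp
    have "(CARD('a) - 1) div 3 = m" using qm by simp
    then have cong: "d_cong z jc jd" using jd_cong by (simp add: d_cong_def w_def)
    have uniq: "c = jc \<and> d = jd" if "cd_rep p q c d" "d_cong z c d" for c d
      using d_cong_unique[OF assms(1,2) card] that assms(4) by simp
    show "\<exists>!(c, d). cd_rep p q c d \<and> d_cong z c d"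
    proof (rule ex1I[of _ "(jc, jd)"])
      show "case (jc, jd) of (c, d) \<Rightarrow> cd_rep p q c d \<and> d_cong z c d" using rep cong by simp
      show "x = (jc, jd)" if "case x of (c, d) \<Rightarrow> cd_rep p q c d \<and> d_cong z c d" for x
        using that uniq by (cases x) blast
    qed
    define N :: "rat fps" where "N = fps_X + fps_const (1 / 2 * of_int (4 + jc - 9 * jd)) * fps_X ^ 2
        + of_int jc * fps_X ^ 3"
    define D :: "rat fps" where "D = 1 - 3 * of_nat q * fps_X ^ 2 - of_nat q * of_int jc * fps_X ^ 3"
    have "jacobi * chib z + cnj jacobi * chi z = of_int ja * (cis3 + cnj cis3)
        + 2 * of_int jb * (cis3 * cnj cis3)"
      unfolding chi_z0 jacobi_eq by (simp add: algebra_simps)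
    also have "\<dots> = of_int (2 * jb - ja)" unfolding cis3_add_cnj cis3_cnj by simp
    finally have g2: "of_int (2 * jb - ja - 2) = jacobi * chib z + cnj jacobi * chi z - 2" by simp
    have g1: "of_int (- 1) = gper z" unfolding gper_def chi_z0 cis3_add_cnj by simp
    have "num_sol_gf z = fps_X / (1 - of_nat q * fps_X) +
      (fps_const (of_int (- 1)) * fps_X
          + fps_const (of_int (2 * jb - ja - 2)) * fps_X ^ 2 - of_int jc * fps_X ^ 3) / D"
      unfolding D_def assms(4)[symmetric] by (rule gf_formula[OF assms(6) g1 g2])
    \<comment> \<open>From \<open>c = 2 a - b\<close> and \<open>b = 3 d\<close> one gets
      \<open>4 + c - 9 d = 2 (a - 2 b + 2)\<close>.\<close>
    moreover have "of_int (2 * jb - ja - 2) = (- (1 / 2 * of_int (4 + jc - 9 * jd)) :: rat)"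
      unfolding jc_def jb_eq by (simp add: field_simps)
    then have "fps_const (of_int (- 1)) * fps_X
        + fps_const (of_int (2 * jb - ja - 2)) * fps_X ^ 2 - of_int jc * fps_X ^ 3 = - N"
      unfolding N_def by (simp add: fps_const_neg[symmetric] del: fps_const_neg)
    \<comment> \<open>The constant coefficient of \<open>D\<close> is 1, so division by
      \<open>D\<close> is multiplication by its inverse.\<close>
    moreover have "- N / D = - (N / D)"
    proof -
      have "fps_nth D 0 \<noteq> 0"
        unfolding D_def by (simp add: fps_of_nat[symmetric] fps_of_int[symmetric] numeral_fps_const mult.assoc)
      then show ?thesis by (simp add: fps_divide_unit)
    qed
    ultimately have gf: "num_sol_gf z = fps_X / (1 - of_nat q * fps_X) - N / D" by simp
    show "\<forall>c d. cd_rep p q c d \<and> d_cong z c d \<longrightarrow>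
        num_sol_gf z =
          fps_X / (1 - of_nat q * fps_X) -
          (fps_X + fps_const (1 / 2 * of_int (4 + c - 9 * d)) * fps_X ^ 2 + of_int c * fps_X ^ 3) /
          (1 - 3 * of_nat q * fps_X ^ 2 - of_nat q * of_int c * fps_X ^ 3)"
    proof (intro allI impI, elim conjE)
      fix c d assume "cd_rep p q c d" "d_cong z c d"
      then have "c = jc" "d = jd" using uniq by auto
      then show "num_sol_gf z =
          fps_X / (1 - of_nat q * fps_X) -
          (fps_X + fps_const (1 / 2 * of_int (4 + c - 9 * d)) * fps_X ^ 2 + of_int c * fps_X ^ 3) /
          (1 - 3 * of_nat q * fps_X ^ 2 - of_nat q * of_int c * fps_X ^ 3)"
        using gf unfolding N_def D_def by simp
    qed
  }
qed

end
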